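(* Let $\mathbb{F}$ be a field with $\mathrm{char}\,\mathbb{F}\neq2$, let $\Phi\subset\{0,1\}$ and $\eta\in\mathbb{F}\setminus\{0,1\}$. (i) A 2-generated $\mathcal{F}_\Phi(\eta)$-axial algebra with $\Phi\neq\{0,1\}$ and $\eta\neq\frac12$, $\eta\neq-1$ is isomorphic to one of the following 10 algebras: $\mathrm{1A}$, $\widehat{\mathrm{1A}}$, $\mathrm{2A}$, $\widehat{\mathrm{2A}}$, $\mathrm{3C}(\eta)$, $\widehat{\mathrm{3C}}(\eta)$, $\mathrm{3C}^{0}(\eta)$, $\mathrm{3C}^{00}(\eta)$, $\widehat{\mathrm{3C}^{0}}(\eta)$, $\widehat{\mathrm{3C}^{00}}(\eta)$. (ii) A 2-generated $\mathcal{F}_\Phi(-1)$-axial algebra with $\Phi\neq\{0,1\}$ is isomorphic to one of the following 16 algebras: the 10 algebras in (i) taken with $\eta=-1$, and $\mathrm{3C}(-1)^\times$, $\widehat{\mathrm{3C}}(-1)^\times$, $\mathrm{3C}^{0}(-1)^\times$, $\mathrm{3C}^{00}(-1)^\times$, $\widehat{\mathrm{3C}^{0}}(-1)^\times$, $\widehat{\mathrm{3C}^{00}}(-1)^\times$.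
   Context: Algebras are commutative, not necessarily associative or unital. For an algebra $M$ over $\mathbb{F}$, $a\in M$ and $s\in\mathbb{F}$ put $M(a,s)=\{x\in M: ax=sx\}$. The fusion rule $\mathcal{F}_\Phi(\eta)$ is the set $\{0,1,\eta\}$ with the symmetric operation $0\star0=\{0\}$, $1\star1=\{1\}$, $0\star1=\Phi$, $0\star\eta=1\star\eta=\{\eta\}$, $\eta\star\eta=\{0,1\}$. An $\mathcal{F}_\Phi(\eta)$-axis of $M$ is an idempotent $a$ with $M=M(a,0)\oplus M(a,1)\oplus M(a,\eta)$ and $M(a,s)M(a,t)\subset\bigoplus_{u\in s\star t}M(a,u)$ for all $s,t\in\{0,1,\eta\}$. An $\mathcal{F}_\Phi(\eta)$-axial algebra is an algebra together with a set of $\mathcal{F}_\Phi(\eta)$-axes generating it as an $\mathbb{F}$-algebra; it is 2-generated if it is generated by two such axes. The algebras, each with its generating axes ($\oplus$ between algebras is direct sum of algebras, with componentwise multiplication): - $\mathrm{1A}=\mathbb{F}a_0$, $a_0a_0=a_0$, regarded formally as generated by $a_0$ and $a_0$. - $\mathrm{2A}=\mathbb{F}s_0\oplus\mathbb{F}s_1$, $s_0s_0=s_0$, $s_1s_1=s_1$, $s_0s_1=0$, generated by $s_0,s_1$. - $\widehat{\mathrm{1A}}=\mathbb{F}a\oplus\mathbb{F}b$ with $aa=a$, $bb=b$, $ab=0$, generated by $a,a+b$. - $\widehat{\mathrm{2A}}=\mathbb{F}a\oplus\mathrm{2A}$ with $aa=a$, generated by $a+s_0,a+s_1$. - $\mathrm{3C}(\eta)$: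 basis $a_{-1},a_0,a_1$, $a_ia_i=a_i$, $a_ia_j=\frac\eta2(a_i+a_j-a_k)$ for $\{i,j,k\}=\{-1,0,1\}$, generated by $a_0,a_1$. - $\widehat{\mathrm{3C}}(\eta)$: basis $\hat q,\hat a_{-1},\hat a_0,\hat a_1$, $\hat qx=(\eta+1)x$ for all $x$, $\hat a_i\hat a_i=\hat a_i$, $\hat a_i\hat a_j=-\frac12\hat q+\frac{\eta+1}2(\hat a_i+\hat a_j)+\frac{1-\eta}2\hat a_k$ for $\{i,j,k\}=\{-1,0,1\}$, generated by $\hat a_0,\hat a_1$. - $\mathrm{3C}^0(\eta)=\mathrm{3C}(\eta)\oplus\mathbb{F}s$ with $ss=s$, generated by $a_0,a_1+s$. - $\mathrm{3C}^{00}(\eta)=\mathrm{3C}(\eta)\oplus\mathrm{2A}$, generated by $a_0+s_0,a_1+s_1$. - $\widehat{\mathrm{3C}^0}(\eta)=\widehat{\mathrm{3C}}(\eta)\oplus\mathbb{F}s$ with $ss=s$, generated by $\hat a_0,\hat a_1+s$. - $\widehat{\mathrm{3C}^{00}}(\eta)=\widehat{\mathrm{3C}}(\eta)\oplus\mathrm{2A}$, generated by $\hat a_0+s_0,\hat a_1+s_1$. For $\eta=-1$: $\mathrm{3C}(-1)^\times$, $\mathrm{3C}^0(-1)^\times$, $\mathrm{3C}^{00}(-1)^\times$ are the quotients of $\mathrm{3C}(-1)$, $\mathrm{3C}^0(-1)$, $\mathrm{3C}^{00}(-1)$ by the ideal $\mathbb{F}(a_0+a_1+a_{-1})$; and $\widehat{\mathrm{3C}}(-1)^\times$,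 $\widehat{\mathrm{3C}^0}(-1)^\times$, $\widehat{\mathrm{3C}^{00}}(-1)^\times$ are the quotients of $\widehat{\mathrm{3C}}(-1)$, $\widehat{\mathrm{3C}^0}(-1)$, $\widehat{\mathrm{3C}^{00}}(-1)$ by the ideal $\mathbb{F}\hat q$.
   Formalization: Part (ii) also assumes η = −1 ≠ 1/2, i.e. char F ≠ 3: in characteristic 3 the 3-dimensional spin factor generated by (1+u)/2, (1+v)/2 is a counterexample. Axes are taken to be nonzero idempotents, since otherwise the zero algebra would be a counterexample. *)

theory Defs
  imports Complex_Main "HOL-Library.Numeral_Type"
begin

section \<open>Axes and 2-generated axial algebras\<close>

locale comm_algebra = vector_space scale
  for scale :: "'f::field \<Rightarrow> 'm::ab_group_add \<Rightarrow> 'm" (infixr \<open>*s\<close> 75) +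
  fixes mult :: "'m \<Rightarrow> 'm \<Rightarrow> 'm" (infixl \<open>\<cdot>\<close> 70)
  assumes mult_commute: "x \<cdot> y = y \<cdot> x"
    and mult_add_left: "(x + y) \<cdot> z = x \<cdot> z + y \<cdot> z"
    and mult_scale_left: "(c *s x) \<cdot> z = c *s (x \<cdot> z)"

definition fusion :: "'f::field set \<Rightarrow> 'f \<Rightarrow> 'f \<Rightarrow> 'f \<Rightarrow> 'f set" where
  "fusion \<Phi> \<eta> s t =
    (if s = 0 \<and> t = 0 then {0}
     else if s = 1 \<and> t = 1 then {1}
     else if s = 0 \<and> t = 1 \<or> s = 1 \<and> t = 0 then \<Phi>
     else if s = \<eta> \<and> t = \<eta> then {0, 1}
     else {\<eta>})"

context comm_algebra
begin

definition eigenspace :: "'m \<Rightarrow> 'f \<Rightarrow> 'm set" where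
  "eigenspace a s = {x. a \<cdot> x = s *s x}"

definition eigenspace_sum :: "'m \<Rightarrow> 'f set \<Rightarrow> 'm set" where
  "eigenspace_sum a S = {\<Sum>u\<in>S. f u |f. \<forall>u\<in>S. f u \<in> eigenspace a u}"

text \<open>
  As usual for axes, idempotents are understood to be nonzero. (The zero vector satisfies all
  the other conditions, and the zero algebra would be generated by it.)
\<close>

definition axis :: "'f set \<Rightarrow> 'f \<Rightarrow> 'm \<Rightarrow> bool" where
  "axis \<Phi> \<eta> a \<longleftrightarrow>
     a \<noteq> 0 \<and> a \<cdot> a = a \<and>
     (\<forall>x. \<exists>!(x0, x1, xe). x0 \<in> eigenspace a 0 \<and> x1 \<in> eigenspace a 1 \<and> xe \<in> eigenspace a \<eta> \<and>
        x = x0 + x1 + xe) \<and>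
     (\<forall>s\<in>{0, 1, \<eta>}. \<forall>t\<in>{0, 1, \<eta>}. \<forall>x\<in>eigenspace a s. \<forall>y\<in>eigenspace a t.
        x \<cdot> y \<in> eigenspace_sum a (fusion \<Phi> \<eta> s t))"

definition subalgebra :: "'m set \<Rightarrow> bool" where
  "subalgebra S \<longleftrightarrow> subspace S \<and> (\<forall>x\<in>S. \<forall>y\<in>S. x \<cdot> y \<in> S)"

definition two_generated :: "'f set \<Rightarrow> 'f \<Rightarrow> 'm \<Rightarrow> 'm \<Rightarrow> bool" where
  "two_generated \<Phi> \<eta> a b \<longleftrightarrow> axis \<Phi> \<eta> a \<and> axis \<Phi> \<eta> b \<and> subalgebra hull {a, b} = UNIV"

end


section \<open>Constructions of algebras and isomorphism\<close>

text \<open>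
  The explicit carrier is there for the sake of quotient algebras, whose elements are cosets.
\<close>

record ('f, 'a) alg =
  carrier :: "'a set"
  add :: "'a \<Rightarrow> 'a \<Rightarrow> 'a"
  smult :: "'f \<Rightarrow> 'a \<Rightarrow> 'a"
  mult :: "'a \<Rightarrow> 'a \<Rightarrow> 'a"

definition type_alg ::
  "('f \<Rightarrow> 'm \<Rightarrow> 'm) \<Rightarrow> ('m \<Rightarrow> 'm \<Rightarrow> 'm) \<Rightarrow> ('f, 'm::ab_group_add) alg" where
  "type_alg scale m = \<lparr>carrier = UNIV, add = (+), smult = scale, mult = m\<rparr>"

definition direct_sum :: "('f, 'a) alg \<Rightarrow> ('f, 'b) alg \<Rightarrow> ('f, 'a \<times> 'b) alg" (infixr \<open>\<oplus>\<close> 65) where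
  "A \<oplus> B =
    \<lparr>carrier = carrier A \<times> carrier B,
     add = (\<lambda>x y. (add A (fst x) (fst y), add B (snd x) (snd y))),
     smult = (\<lambda>c x. (smult A c (fst x), smult B c (snd x))),
     mult = (\<lambda>x y. (mult A (fst x) (fst y), mult B (snd x) (snd y)))\<rparr>"

definition coset :: "('f, 'a) alg \<Rightarrow> 'a set \<Rightarrow> 'a \<Rightarrow> 'a set" where
  "coset A I x = (\<lambda>i. add A x i) ` I"

definition quotient_alg :: "('f, 'a) alg \<Rightarrow> 'a set \<Rightarrow> ('f, 'a set) alg" where
  "quotient_alg A I =
    \<lparr>carrier = coset A I ` carrier A,
     add = (\<lambda>X Y. \<Union>x\<in>X. \<Union>y\<in>Y. coset A I (add A x y)),
     smult = (\<lambda>c X. \<Union>x\<in>X. coset A I (smult A c x)),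
     mult = (\<lambda>X Y. \<Union>x\<in>X. \<Union>y\<in>Y. coset A I (mult A x y))\<rparr>"

text \<open>
  An algebra with a basis indexed by a finite type: elements are coordinate functions, and
  \<open>c i j k\<close> is the coefficient at the \<open>k\<close>-th basis vector of the product of the \<open>i\<close>-th and the
  \<open>j\<close>-th one.
\<close>

definition basis_alg :: "('i::finite \<Rightarrow> 'i \<Rightarrow> 'i \<Rightarrow> 'f::field) \<Rightarrow> ('f, 'i \<Rightarrow> 'f) alg" where
  "basis_alg c =
    \<lparr>carrier = UNIV,
     add = (\<lambda>x y k. x k + y k),
     smult = (\<lambda>r x k. r * x k),
     mult = (\<lambda>x y k. \<Sum>i\<in>UNIV. \<Sum>j\<in>UNIV. x i * y j * c i j k)\<rparr>"

definition basis_vec :: "'i \<Rightarrow> 'i \<Rightarrow> 'f::field" where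
  "basis_vec i = (\<lambda>k. if k = i then 1 else 0)"

text \<open>
  A pair \<open>(A, S)\<close> stands for the algebra \<open>A\<close> together with its set \<open>S\<close> of generating axes;
  isomorphisms respect the generating axes. (As mere algebras, \<open>\<FF>a \<oplus> \<FF>b\<close> with generators
  \<open>a, a + b\<close> and with generators \<open>a, b\<close> would not be distinguished.)
\<close>

type_synonym ('f, 'a) axial = "('f, 'a) alg \<times> 'a set"

definition isomorphic :: "('f, 'a) axial \<Rightarrow> ('f, 'b) axial \<Rightarrow> bool" (infix \<open>\<cong>\<close> 50) where
  "X \<cong> Y \<longleftrightarrow>
    (case (X, Y) of ((A, S), (B, T)) \<Rightarrow>
      \<exists>f. bij_betw f (carrier A) (carrier B) \<and>
        (\<forall>x\<in>carrier A. \<forall>y\<in>carrier A. f (add A x y) = add B (f x) (f y)) \<and>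
        (\<forall>c. \<forall>x\<in>carrier A. f (smult A c x) = smult B c (f x)) \<and>
        (\<forall>x\<in>carrier A. \<forall>y\<in>carrier A. f (mult A x y) = mult B (f x) (f y)) \<and>
        f ` S = T)"

definition axial_quotient :: "('f, 'a) axial \<Rightarrow> 'a \<Rightarrow> ('f, 'a set) axial" where
  "axial_quotient X v =
    (case X of (A, S) \<Rightarrow>
      let I = range (\<lambda>c. smult A c v) in (quotient_alg A I, coset A I ` S))"


section \<open>The algebras of the classification\<close>

text \<open>The one-dimensional algebra spanned by an idempotent, which is the element \<open>1\<close>.\<close>

definition line_alg :: "('f::field, 'f) alg" where
  "line_alg = \<lparr>carrier = UNIV, add = (+), smult = (*), mult = (*)\<rparr>"

definition alg_2A :: "('f::field, 'f \<times> 'f) alg" where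
  "alg_2A = line_alg \<oplus> line_alg"

text \<open>
  The index type \<open>3\<close> has exactly the elements \<open>-1, 0, 1\<close>; for \<open>i \<noteq> j\<close> the case
  \<open>k \<notin> {i, j}\<close> is the remaining index.
\<close>

definition alg_3C :: "'f::field \<Rightarrow> ('f, 3 \<Rightarrow> 'f) alg" where
  "alg_3C \<eta> = basis_alg (\<lambda>i j.
     if i = j then basis_vec i
     else (\<lambda>k. if k \<in> {i, j} then \<eta> / 2 else - (\<eta> / 2)))"

text \<open>Here \<open>None\<close> is the index of \<open>q\<close>, and \<open>Some i\<close> that of the \<open>i\<close>-th axis.\<close>

fun hat_3C_coeff :: "'f::field \<Rightarrow> 3 option \<Rightarrow> 3 option \<Rightarrow> 3 option \<Rightarrow> 'f" where
  "hat_3C_coeff \<eta> None j = (\<lambda>k. (\<eta> + 1) * basis_vec j k)"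
| "hat_3C_coeff \<eta> (Some i) None = (\<lambda>k. (\<eta> + 1) * basis_vec (Some i) k)"
| "hat_3C_coeff \<eta> (Some i) (Some j) =
     (if i = j then basis_vec (Some i)
      else (\<lambda>k. case k of None \<Rightarrow> - (1 / 2)
                | Some k' \<Rightarrow> if k' \<in> {i, j} then (\<eta> + 1) / 2 else (1 - \<eta>) / 2))"

definition alg_hat_3C :: "'f::field \<Rightarrow> ('f, 3 option \<Rightarrow> 'f) alg" where
  "alg_hat_3C \<eta> = basis_alg (hat_3C_coeff \<eta>)"

abbreviation a_vec :: "3 \<Rightarrow> 3 \<Rightarrow> 'f::field" where
  "a_vec i \<equiv> basis_vec i"

abbreviation hat_a_vec :: "3 \<Rightarrow> 3 option \<Rightarrow> 'f::field" where
  "hat_a_vec i \<equiv> basis_vec (Some i)"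

abbreviation hat_q_vec :: "3 option \<Rightarrow> 'f::field" where
  "hat_q_vec \<equiv> basis_vec None"

definition a_sum :: "3 \<Rightarrow> 'f::field" where
  "a_sum = (\<lambda>k. a_vec 0 k + a_vec 1 k + a_vec (-1) k)"

definition ax_1A :: "('f::field, 'f) axial" where
  "ax_1A = (line_alg, {1, 1})"

definition ax_hat_1A :: "('f::field, 'f \<times> 'f) axial" where
  "ax_hat_1A = (line_alg \<oplus> line_alg, {(1, 0), (1, 1)})"

definition ax_2A :: "('f::field, 'f \<times> 'f) axial" where
  "ax_2A = (alg_2A, {(1, 0), (0, 1)})"

definition ax_hat_2A :: "('f::field, 'f \<times> 'f \<times> 'f) axial" where
  "ax_hat_2A = (line_alg \<oplus> alg_2A, {(1, 1, 0), (1, 0, 1)})"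

definition ax_3C :: "'f::field \<Rightarrow> ('f, 3 \<Rightarrow> 'f) axial" where
  "ax_3C \<eta> = (alg_3C \<eta>, {a_vec 0, a_vec 1})"

definition ax_hat_3C :: "'f::field \<Rightarrow> ('f, 3 option \<Rightarrow> 'f) axial" where
  "ax_hat_3C \<eta> = (alg_hat_3C \<eta>, {hat_a_vec 0, hat_a_vec 1})"

definition ax_3C0 :: "'f::field \<Rightarrow> ('f, (3 \<Rightarrow> 'f) \<times> 'f) axial" where
  "ax_3C0 \<eta> = (alg_3C \<eta> \<oplus> line_alg, {(a_vec 0, 0), (a_vec 1, 1)})"

definition ax_3C00 :: "'f::field \<Rightarrow> ('f, (3 \<Rightarrow> 'f) \<times> 'f \<times> 'f) axial" where
  "ax_3C00 \<eta> = (alg_3C \<eta> \<oplus> alg_2A, {(a_vec 0, 1, 0), (a_vec 1, 0, 1)})"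

definition ax_hat_3C0 :: "'f::field \<Rightarrow> ('f, (3 option \<Rightarrow> 'f) \<times> 'f) axial" where
  "ax_hat_3C0 \<eta> = (alg_hat_3C \<eta> \<oplus> line_alg, {(hat_a_vec 0, 0), (hat_a_vec 1, 1)})"

definition ax_hat_3C00 :: "'f::field \<Rightarrow> ('f, (3 option \<Rightarrow> 'f) \<times> 'f \<times> 'f) axial" where
  "ax_hat_3C00 \<eta> = (alg_hat_3C \<eta> \<oplus> alg_2A, {(hat_a_vec 0, 1, 0), (hat_a_vec 1, 0, 1)})"

definition ax_3C_cross :: "('f::field, (3 \<Rightarrow> 'f) set) axial" where
  "ax_3C_cross = axial_quotient (ax_3C (-1)) a_sum"

definition ax_3C0_cross :: "('f::field, ((3 \<Rightarrow> 'f) \<times> 'f) set) axial" where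
  "ax_3C0_cross = axial_quotient (ax_3C0 (-1)) (a_sum, 0)"

definition ax_3C00_cross :: "('f::field, ((3 \<Rightarrow> 'f) \<times> 'f \<times> 'f) set) axial" where
  "ax_3C00_cross = axial_quotient (ax_3C00 (-1)) (a_sum, 0, 0)"

definition ax_hat_3C_cross :: "('f::field, (3 option \<Rightarrow> 'f) set) axial" where
  "ax_hat_3C_cross = axial_quotient (ax_hat_3C (-1)) hat_q_vec"

definition ax_hat_3C0_cross :: "('f::field, ((3 option \<Rightarrow> 'f) \<times> 'f) set) axial" where
  "ax_hat_3C0_cross = axial_quotient (ax_hat_3C0 (-1)) (hat_q_vec, 0)"

definition ax_hat_3C00_cross :: "('f::field, ((3 option \<Rightarrow> 'f) \<times> 'f \<times> 'f) set) axial" where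
  "ax_hat_3C00_cross = axial_quotient (ax_hat_3C00 (-1)) (hat_q_vec, 0, 0)"

definition isomorphic_to_one_of_ten :: "('f::field, 'a) axial \<Rightarrow> 'f \<Rightarrow> bool" where
  "isomorphic_to_one_of_ten X \<eta> \<longleftrightarrow>
     X \<cong> ax_1A \<or> X \<cong> ax_hat_1A \<or> X \<cong> ax_2A \<or> X \<cong> ax_hat_2A \<or>
     X \<cong> ax_3C \<eta> \<or> X \<cong> ax_hat_3C \<eta> \<or> X \<cong> ax_3C0 \<eta> \<or> X \<cong> ax_3C00 \<eta> \<or>
     X \<cong> ax_hat_3C0 \<eta> \<or> X \<cong> ax_hat_3C00 \<eta>"

end

theory Submission
  imports Defs
begin

text \<open>
  Write \<open>\<phi>\<close> for the eigenvalue with \<open>M(a,0) M(a,1) \<subseteq> M(a,\<phi>)\<close>. The Miyamoto involutions of \<open>a\<close>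
  and \<open>b\<close> generate a dihedral group, and the images of \<open>a\<close> and \<open>b\<close> form a sequence \<open>al n\<close>
  with \<open>al 0 = a\<close>, \<open>al 1 = b\<close>, on which the involution of \<open>al n\<close> acts as the reflection
  \<open>m \<mapsto> 2n - m\<close>. The element \<open>p = al n \<cdot> al (n+1) - \<eta> (al n + al (n+1))\<close> does not depend on
  \<open>n\<close>. The fusion rules on \<open>M(al n,0) + M(al n,1)\<close> express \<open>p \<cdot> p\<close> linearly in terms of
  elements near \<open>n\<close>; comparing two consecutive values of \<open>n\<close> gives a linear recurrence for
  \<open>al\<close> with characteristic polynomial \<open>(1+x)(1-x\<^sup>3)(\<kappa>(1+x\<^sup>2)/2 - x)\<close>, where
  \<open>\<kappa> = \<eta>\<close> or \<open>1 - \<eta>\<close>. The quadratic factor is removed by the commutativity of two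
  products, so that \<open>al\<close> has period 6. Then \<open>\<delta> = al 2 - al (-1)\<close> splits off two orthogonal
  idempotents \<open>s0 = a \<cdot> \<delta>\<close> and \<open>s1 = - b \<cdot> \<delta>\<close>, and what remains satisfies the
  multiplication table of the algebra \<open>3C\<close> with a hat. Hence \<open>M\<close> is a quotient of the direct sum
  of that algebra and \<open>2A\<close>, and the ideals of this sum are easily listed.
\<close>

section \<open>Linear identities\<close>

context comm_algebra
begin

definition functional :: "('m \<Rightarrow> 'f) \<Rightarrow> bool" where
  "functional f \<longleftrightarrow> (\<forall>x y. f (x + y) = f x + f y) \<and> (\<forall>c x. f (c *s x) = c * f x)"

lemma functional_zero: "functional f \<Longrightarrow> f 0 = 0"
  unfolding functional_def by (metis scale_zero_left mult_zero_left)

lemma functional_minus: "functional f \<Longrightarrow> f (- x) = - f x"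
  unfolding functional_def by (metis scale_minus_left scale_one mult_minus1)

lemma functional_simps:
  assumes "functional f"
  shows "f (x + y) = f x + f y" "f (x - y) = f x - f y" "f (- x) = - f x" "f (c *s x) = c * f x"
    "f 0 = 0"
proof -
  show add: "f (x + y) = f x + f y" and "f (c *s x) = c * f x" for x y
    using assms unfolding functional_def by auto
  show "f (- x) = - f x" "f 0 = 0"
    using functional_minus[OF assms] functional_zero[OF assms] by auto
  show "f (x - y) = f x - f y"
    using add[of x "- y"] functional_minus[OF assms] by simp
qed

text \<open>
  Turns a linear identity between vectors into one between scalars, where \<open>algebra\<close> applies.
\<close>

lemma eq_by_functionals:
  assumes "\<And>f. functional f \<Longrightarrow> f x = f y"
  shows "x = y"
proof -
  \<comment> \<open>Coordinates with respect to a basis of the whole space are functionals, and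
    together they separate vectors.\<close>
  define B where "B = extend_basis {}"
  have B: "independent B" "span B = UNIV"
    unfolding B_def by (simp_all add: independent_extend_basis independent_empty)
  have "representation B x = representation B y"
  proof
    fix b
    have "functional (\<lambda>x. representation B x b)"
      unfolding functional_def using B representation_add representation_scale by simp
    then show "representation B x b = representation B y b" by (rule assms)
  qed
  moreover have "x = (\<Sum>b | representation B x b \<noteq> 0. representation B x b *s b)"
    "y = (\<Sum>b | representation B y b \<noteq> 0. representation B y b *s b)"
    using B by (simp_all add: sum_nonzero_representation_eq)
  ultimately show ?thesis by metis
qed

lemma mult_add_right: "x \<cdot> (y + z) = x \<cdot> y + x \<cdot> z"
  by (metis mult_commute mult_add_left)

lemma mult_scale_right: "x \<cdot> (c *s z) = c *s (x \<cdot> z)"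
  by (metis mult_commute mult_scale_left)

lemma mult_zero_left [simp]: "0 \<cdot> x = 0"
  by (metis scale_zero_left mult_scale_left)

lemma mult_zero_right [simp]: "x \<cdot> 0 = 0"
  by (metis mult_commute mult_zero_left)

lemma mult_minus_left: "(- x) \<cdot> y = - (x \<cdot> y)"
  by (metis scale_minus_left scale_one mult_scale_left)

lemma mult_minus_right: "x \<cdot> (- y) = - (x \<cdot> y)"
  by (metis mult_commute mult_minus_left)

lemma mult_diff_left: "(x - y) \<cdot> z = x \<cdot> z - y \<cdot> z"
  by (metis mult_add_left mult_minus_left diff_conv_add_uminus)

lemma mult_diff_right: "z \<cdot> (x - y) = z \<cdot> x - z \<cdot> y"
  by (metis mult_commute mult_diff_left)

lemmas bilinear = mult_add_left mult_add_right mult_diff_left mult_diff_right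
  mult_minus_left mult_minus_right mult_scale_left mult_scale_right

end

section \<open>Sequences of axes\<close>

text \<open>The multiplication rules of \<open>3C\<close> with a hat, with \<open>A2\<close> as the
  axis of index -1 and products doubled to avoid fractions, next to an orthogonal pair
  \<open>s0\<close>, \<open>s1\<close> as in \<open>2A\<close>. The elements may vanish or be
  linearly dependent, so that every quotient of the direct sum is covered.\<close>

locale hat_3C_relations = comm_algebra scale mult
  for scale :: "'f::field \<Rightarrow> 'm::ab_group_add \<Rightarrow> 'm" (infixr \<open>*s\<close> 75)
    and mult :: "'m \<Rightarrow> 'm \<Rightarrow> 'm" (infixl \<open>\<cdot>\<close> 70) +
  fixes \<eta> :: 'f and A0 A1 A2 q s0 s1 :: 'm
  assumes two: "(2::'f) \<noteq> 0" and \<eta>: "\<eta> \<noteq> 0" "\<eta> \<noteq> 1"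
    and A_idem: "A0 \<cdot> A0 = A0" "A1 \<cdot> A1 = A1" "A2 \<cdot> A2 = A2"
    and A_mult: "2 *s (A0 \<cdot> A1) = (\<eta> + 1) *s (A0 + A1) + (1 - \<eta>) *s A2 - q"
      "2 *s (A0 \<cdot> A2) = (\<eta> + 1) *s (A0 + A2) + (1 - \<eta>) *s A1 - q"
      "2 *s (A1 \<cdot> A2) = (\<eta> + 1) *s (A1 + A2) + (1 - \<eta>) *s A0 - q"
    and q_A: "q \<cdot> A0 = (\<eta> + 1) *s A0" "q \<cdot> A1 = (\<eta> + 1) *s A1" "q \<cdot> A2 = (\<eta> + 1) *s A2"
    and q_q: "q \<cdot> q = (\<eta> + 1) *s q"
    and s_mult: "s0 \<cdot> s0 = s0" "s1 \<cdot> s1 = s1" "s0 \<cdot> s1 = 0"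
    and s0_A: "s0 \<cdot> A0 = 0" "s0 \<cdot> A1 = 0" "s0 \<cdot> A2 = 0" "s0 \<cdot> q = 0"
    and s1_A: "s1 \<cdot> A0 = 0" "s1 \<cdot> A1 = 0" "s1 \<cdot> A2 = 0" "s1 \<cdot> q = 0"

text \<open>The involutions enter only through their effect on the sequence: \<open>odd_part\<close>
  puts the difference of two mirror images into the \<eta>-eigenspace of the centre, and
  \<open>even_part\<close> puts their sum into the sum of the eigenspaces for 0 and 1.\<close>

locale axis_sequence = comm_algebra scale mult
  for scale :: "'f::field \<Rightarrow> 'm::ab_group_add \<Rightarrow> 'm" (infixr \<open>*s\<close> 75)
    and mult :: "'m \<Rightarrow> 'm \<Rightarrow> 'm" (infixl \<open>\<cdot>\<close> 70) +
  fixes al :: "int \<Rightarrow> 'm" and \<eta> \<phi> \<kappa> :: 'f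
  assumes idem: "al n \<cdot> al n = al n"
    and odd_part: "al n \<cdot> (al m - al (2 * n - m)) = \<eta> *s (al m - al (2 * n - m))"
    and even_part: "al n \<cdot> (al n \<cdot> (al m + al (2 * n - m))) = al n \<cdot> (al m + al (2 * n - m))"
    and fusion_11: "al n \<cdot> x = x \<Longrightarrow> al n \<cdot> y = y \<Longrightarrow> al n \<cdot> (x \<cdot> y) = x \<cdot> y"
    and fusion_00: "al n \<cdot> x = 0 \<Longrightarrow> al n \<cdot> y = 0 \<Longrightarrow> al n \<cdot> (x \<cdot> y) = 0"
    and fusion_01: "al n \<cdot> x = 0 \<Longrightarrow> al n \<cdot> y = y \<Longrightarrow> al n \<cdot> (x \<cdot> y) = \<phi> *s (x \<cdot> y)"
    and cases_\<phi>: "\<phi> = 0 \<and> \<kappa> = \<eta> \<or> \<phi> = 1 \<and> \<kappa> = 1 - \<eta>"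
    and two_neq_0: "(2::'f) \<noteq> 0"
    and \<eta>_neq: "\<eta> \<noteq> 0" "\<eta> \<noteq> 1" "2 * \<eta> \<noteq> 1"
begin

section \<open>Products of terms at distance one and two\<close>

definition p where "p = al 0 \<cdot> al 1 - \<eta> *s (al 0 + al 1)"
text \<open>The analogue of \<open>p\<close> for distance two; it will depend only on the parity of
  \<open>n\<close>.\<close>

definition r where "r n = al n \<cdot> al (n + 2) - \<eta> *s (al n + al (n + 2))"

lemma \<kappa>_neq: "\<kappa> \<noteq> 0" "\<kappa> \<noteq> 1" "2 * \<kappa> \<noteq> 1"
proof -
  show "\<kappa> \<noteq> 0" "\<kappa> \<noteq> 1" using cases_\<phi> \<eta>_neq by auto
  have "2 * (1 - \<eta>) = 1 \<longleftrightarrow> 2 * \<eta> = 1" by algebra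
  then show "2 * \<kappa> \<noteq> 1" using cases_\<phi> \<eta>_neq by auto
qed

text \<open>This is \<open>odd_part\<close> for the neighbours of \<open>al n\<close>,
  rearranged.\<close>

lemma p_shift: "al n \<cdot> al (n + 1) - \<eta> *s (al n + al (n + 1)) =
    al (n - 1) \<cdot> al n - \<eta> *s (al (n - 1) + al n)"
proof -
  have "2 * n - (n + 1) = n - 1" by simp
  then show ?thesis
    using odd_part[of n "n + 1"] mult_commute[of "al (n - 1)" "al n"]
    by (simp add: bilinear algebra_simps)
qed

lemma p_eq: "p = al n \<cdot> al (n + 1) - \<eta> *s (al n + al (n + 1))"
proof (induction n rule: int_induct[of _ 0])
  case base then show ?case by (simp add: p_def)
next
  case (step1 i) then show ?case using p_shift[of "i + 1"] by simp
next
  case (step2 i) then show ?case using p_shift[of i] by simp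
qed

lemma mult_next: "al n \<cdot> al (n + 1) = p + \<eta> *s (al n + al (n + 1))"
  by (simp add: p_eq[of n])

lemma mult_prev: "al n \<cdot> al (n - 1) = p + \<eta> *s (al n + al (n - 1))"
  using mult_next[of "n - 1"] by (simp add: mult_commute add.commute)

lemma mult_next2: "al n \<cdot> al (n + 2) = r n + \<eta> *s (al n + al (n + 2))"
  by (simp add: r_def)

lemma r_prev: "r (n - 2) = r n"
proof -
  have "2 * n - (n + 2) = n - 2" by simp
  then show ?thesis
    using odd_part[of n "n + 2"] mult_commute[of "al (n - 2)" "al n"]
    by (simp add: r_def bilinear algebra_simps)
qed

lemma r_next: "r (n + 2) = r n"
  using r_prev[of "n + 2"] by simp

lemma mult_prev2: "al n \<cdot> al (n - 2) = r n + \<eta> *s (al n + al (n - 2))"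
  using mult_next2[of "n - 2"] r_prev[of n] by (simp add: mult_commute add.commute)

text \<open>By \<open>even_part\<close>, the product of \<open>al n\<close> with the sum of its
  neighbours is fixed by \<open>al n\<close>. That product contains \<open>2 *s p\<close>, so the
  equation can be solved for \<open>al n \<cdot> p\<close>.\<close>

lemma mult_p: "2 *s (al n \<cdot> p) = (2 * (1 - \<eta>)) *s p - (2 * \<eta>\<^sup>2) *s al n
    + (\<eta> * (1 - \<eta>)) *s (al (n + 1) + al (n - 1))"
proof (rule eq_by_functionals)
  fix f assume f: "functional f"
  have *: "2 * n - (n + 1) = n - 1" by simp
  have "f (al n \<cdot> (al n \<cdot> (al (n+1) + al (n-1)))) = f (al n \<cdot> (al (n+1) + al (n-1)))"
    using even_part[of n "n + 1"] unfolding * by simp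
  then show "f (2 *s (al n \<cdot> p)) = f ((2 * (1 - \<eta>)) *s p - (2 * \<eta>\<^sup>2) *s al n
    + (\<eta> * (1 - \<eta>)) *s (al (n + 1) + al (n - 1)))"
    unfolding bilinear mult_next mult_prev idem functional_simps[OF f] by algebra
qed

lemma mult_r: "2 *s (al n \<cdot> r n) = (2 * (1 - \<eta>)) *s r n - (2 * \<eta>\<^sup>2) *s al n
    + (\<eta> * (1 - \<eta>)) *s (al (n + 2) + al (n - 2))"
proof (rule eq_by_functionals)
  fix f assume f: "functional f"
  have *: "2 * n - (n + 2) = n - 2" by simp
  have "f (al n \<cdot> (al n \<cdot> (al (n+2) + al (n-2)))) = f (al n \<cdot> (al (n+2) + al (n-2)))"
    using even_part[of n "n + 2"] unfolding * by simp
  then show "f (2 *s (al n \<cdot> r n)) = f ((2 * (1 - \<eta>)) *s r n - (2 * \<eta>\<^sup>2) *s al n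
    + (\<eta> * (1 - \<eta>)) *s (al (n + 2) + al (n - 2)))"
    unfolding bilinear mult_next2 mult_prev2 idem functional_simps[OF f] by algebra
qed

text \<open>The sum \<open>X\<close> of the neighbours splits into eigenvectors \<open>X0\<close>
  and \<open>X1\<close> of \<open>al n\<close>. The products \<open>X \<cdot> X\<close> and
  \<open>p \<cdot> X\<close> are computed once from the rules for the sequence and once from these
  components; the fusion rule then separates the products of the components.\<close>

lemma fusion_relations:
  fixes n
  defines "X \<equiv> al (n + 1) + al (n - 1)" and "Y \<equiv> al (n + 2) + al (n - 2)"
  shows mult_X: "al n \<cdot> X = 2 *s p + (2 * \<eta>) *s al n + \<eta> *s X"
    and mult_Y: "al n \<cdot> Y = 2 *s r n + (2 * \<eta>) *s al n + \<eta> *s Y"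
    and mult_r_next: "2 *s (al n \<cdot> r (n + 1)) = (if \<phi> = 0
          then (1 - 2 * \<eta>) *s (al n \<cdot> X) + \<eta> *s (al n \<cdot> Y) - (2 * \<eta>) *s al n
          else 2 *s r (n + 1) + (2 * \<eta> - 1) *s (X - al n \<cdot> X) + (1 - \<eta>) *s (Y - al n \<cdot> Y))"
    and p_square: "4 *s (p \<cdot> p) = ((2 * \<eta> - 1) * \<kappa>) *s (\<kappa> *s Y + (\<kappa> - 2) *s X
            + (2 * (\<kappa> - 1)) *s al n)
          + (2 * \<kappa>) *s r n - (2 * \<kappa>\<^sup>2) *s r (n + 1) + (4 * (2 * (1 - \<eta>)\<^sup>2 - 1)) *s p"
proof -
  show X1: "al n \<cdot> X = 2 *s p + (2 * \<eta>) *s al n + \<eta> *s X"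
  proof (rule eq_by_functionals)
    fix f assume f: "functional f"
    show "f (al n \<cdot> X) = f (2 *s p + (2 * \<eta>) *s al n + \<eta> *s X)"
      unfolding X_def bilinear mult_next mult_prev functional_simps[OF f] by algebra
  qed
  show Y1: "al n \<cdot> Y = 2 *s r n + (2 * \<eta>) *s al n + \<eta> *s Y"
  proof (rule eq_by_functionals)
    fix f assume f: "functional f"
    show "f (al n \<cdot> Y) = f (2 *s r n + (2 * \<eta>) *s al n + \<eta> *s Y)"
      unfolding Y_def bilinear mult_next2 mult_prev2 functional_simps[OF f] by algebra
  qed
  define X1 X0 where "X1 = al n \<cdot> X" and "X0 = X - X1"
  have e1: "al n \<cdot> X1 = X1" and e0: "al n \<cdot> X0 = 0"
    using even_part[of n "n + 1"] unfolding X1_def X0_def X_def by (simp_all add: bilinear)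
  have f11: "al n \<cdot> (X1 \<cdot> X1) = X1 \<cdot> X1" and f00: "al n \<cdot> (X0 \<cdot> X0) = 0"
    and f01: "al n \<cdot> (X0 \<cdot> X1) = \<phi> *s (X0 \<cdot> X1)"
    using fusion_11[OF e1 e1] fusion_00[OF e0 e0] fusion_01[OF e0 e1] .
  have X: "X = X0 + X1" by (simp add: X0_def)
  have XX: "X \<cdot> X = (1 + 2 * \<eta>) *s X + 2 *s r (n + 1)"
  proof (rule eq_by_functionals)
    fix f assume f: "functional f"
    have m1: "al (n + 1) \<cdot> al (n - 1) = r (n + 1) + \<eta> *s (al (n + 1) + al (n - 1))"
      using mult_prev2[of "n + 1"] by simp
    from this have m2: "al (n - 1) \<cdot> al (n + 1) = r (n + 1) + \<eta> *s (al (n + 1) + al (n - 1))"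
      by (simp add: mult_commute)
    show "f (X \<cdot> X) = f ((1 + 2 * \<eta>) *s X + 2 *s r (n + 1))"
      unfolding X_def bilinear by (simp only: m1 m2 idem functional_simps[OF f]) algebra
  qed
  have pX: "2 *s (p \<cdot> X) = (\<eta> * (1 - \<eta>)) *s (2 *s al n + Y) + (4 * (1 - \<eta>)) *s p - (2 * \<eta>\<^sup>2) *s X"
  proof (rule eq_by_functionals)
    fix f assume f: "functional f"
    have m: "2 *s (p \<cdot> X) = 2 *s (al (n + 1) \<cdot> p) + 2 *s (al (n - 1) \<cdot> p)"
      unfolding X_def by (simp add: bilinear mult_commute[of p] scale_right_distrib)
    show "f (2 *s (p \<cdot> X)) = f ((\<eta> * (1 - \<eta>)) *s (2 *s al n + Y) + (4 * (1 - \<eta>)) *s p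
        - (2 * \<eta>\<^sup>2) *s X)"
      unfolding m unfolding mult_p X_def Y_def by (simp add: functional_simps[OF f] add.commute) algebra
  qed
  \<comment> \<open>Since \<open>al n \<cdot> X\<close> contains \<open>2 *s p\<close>, also
    \<open>p\<close> is a combination of \<open>X0\<close>, \<open>X1\<close> and
    \<open>al n\<close>.\<close>
  have p2: "2 *s p = (1 - \<eta>) *s X1 - \<eta> *s X0 - (2 * \<eta>) *s al n"
    unfolding X0_def X1_def X1
    by (rule eq_by_functionals) (simp only: functional_simps, algebra)
  have pX': "2 *s (p \<cdot> X) = (1 - \<eta>) *s (X1 \<cdot> X1) + (1 - 2 * \<eta>) *s (X0 \<cdot> X1) - \<eta> *s (X0 \<cdot> X0)
      - (2 * \<eta>) *s X1"
  proof -
    have "2 *s (p \<cdot> X) = (2 *s p) \<cdot> (X0 + X1)" by (simp add: mult_scale_left X)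
    also have "\<dots> = (1 - \<eta>) *s (X1 \<cdot> X1) + (1 - 2 * \<eta>) *s (X0 \<cdot> X1) - \<eta> *s (X0 \<cdot> X0)
      - (2 * \<eta>) *s X1"
      unfolding p2 bilinear e0 e1 mult_commute[of X1 X0]
      by (rule eq_by_functionals) (simp only: functional_simps, algebra)
    finally show ?thesis .
  qed
  have pp: "4 *s (p \<cdot> p) = (1 - \<eta>)\<^sup>2 *s (X1 \<cdot> X1) + \<eta>\<^sup>2 *s (X0 \<cdot> X0) - (2 * \<eta> * (1 - \<eta>)) *s (X0 \<cdot> X1)
      + (4 * \<eta>\<^sup>2) *s al n - (4 * \<eta> * (1 - \<eta>)) *s X1"
  proof -
    have "4 *s (p \<cdot> p) = (2 *s p) \<cdot> (2 *s p)" by (simp add: bilinear)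
    also have "\<dots> = (1 - \<eta>)\<^sup>2 *s (X1 \<cdot> X1) + \<eta>\<^sup>2 *s (X0 \<cdot> X0) - (2 * \<eta> * (1 - \<eta>)) *s (X0 \<cdot> X1)
      + (4 * \<eta>\<^sup>2) *s al n - (4 * \<eta> * (1 - \<eta>)) *s X1"
      unfolding p2 bilinear e0 e1 mult_commute[of X1 X0] mult_commute[of X0 "al n"] mult_commute[of X1 "al n"] e0 e1 idem
      by (rule eq_by_functionals) (simp only: functional_simps, algebra)
    finally show ?thesis .
  qed
  have XX': "X \<cdot> X = X1 \<cdot> X1 + 2 *s (X0 \<cdot> X1) + X0 \<cdot> X0"
    unfolding X bilinear mult_commute[of X1 X0]
    by (rule eq_by_functionals) (simp only: functional_simps, algebra)
  \<comment> \<open>Multiplication by \<open>al n\<close> removes \<open>X0 \<cdot> X0\<close>,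
    keeps \<open>X1 \<cdot> X1\<close> and scales the mixed product by \<phi>.\<close>
  have apX: "(1 - \<eta>) *s (X1 \<cdot> X1) + ((1 - 2 * \<eta>) * \<phi>) *s (X0 \<cdot> X1) - (2 * \<eta>) *s X1
      = (\<eta> * (1 - \<eta>)) *s (2 *s al n + al n \<cdot> Y) + (4 * (1 - \<eta>)) *s (al n \<cdot> p) - (2 * \<eta>\<^sup>2) *s X1"
    using arg_cong[OF trans[OF pX'[symmetric] pX], of "mult (al n)"]
    unfolding bilinear f11 f00 f01 e1 idem X1_def[symmetric] by simp
  have aXX: "X1 \<cdot> X1 + (2 * \<phi>) *s (X0 \<cdot> X1) = (1 + 2 * \<eta>) *s X1 + 2 *s (al n \<cdot> r (n + 1))"
    using arg_cong[OF trans[OF XX'[symmetric] XX], of "mult (al n)"]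
    unfolding bilinear f11 f00 f01 e1 idem X1_def[symmetric] by simp
  have ap: "2 *s (al n \<cdot> p) = (1 - \<eta>) *s X1 - (2 * \<eta>) *s al n"
    using arg_cong[OF p2, of "mult (al n)"] unfolding bilinear e0 e1 idem by simp
  \<comment> \<open>For \<phi> = 0 the mixed product is removed too, which leaves an equation for
    \<open>X1 \<cdot> X1\<close>.\<close>
  have X11: "X1 \<cdot> X1 = 2 *s X1 + \<eta> *s (al n \<cdot> Y) - (2 * \<eta>) *s al n" if "\<phi> = 0"
  proof -
    have "(1 - \<eta>) *s (X1 \<cdot> X1) = (1 - \<eta>) *s (2 *s X1 + \<eta> *s (al n \<cdot> Y) - (2 * \<eta>) *s al n)"
    proof (rule eq_by_functionals)
      fix f assume f: "functional f"
      note * = apX[THEN arg_cong[where f=f], unfolded functional_simps[OF f]]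
        ap[THEN arg_cong[where f=f], unfolded functional_simps[OF f]]
      show "f ((1 - \<eta>) *s (X1 \<cdot> X1)) = f ((1 - \<eta>) *s (2 *s X1 + \<eta> *s (al n \<cdot> Y) - (2 * \<eta>) *s al n))"
        unfolding functional_simps[OF f] using * that by algebra
    qed
    then show ?thesis using \<eta>_neq by simp
  qed
  \<comment> \<open>For \<phi> = 1 the mixed product is kept, so subtracting \<open>apX\<close> from
    the expansion of \<open>p \<cdot> X\<close> leaves an equation for
    \<open>X0 \<cdot> X0\<close>.\<close>
  have X00: "X0 \<cdot> X0 = 2 *s X0 - (1 - \<eta>) *s (Y - al n \<cdot> Y)" if "\<phi> = 1"
  proof -
    have "\<eta> *s (X0 \<cdot> X0) = \<eta> *s (2 *s X0 - (1 - \<eta>) *s (Y - al n \<cdot> Y))"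
    proof (rule eq_by_functionals)
      fix f assume f: "functional f"
      note eqs = apX ap pX pX' p2 X
      note * = eqs[THEN arg_cong[where f=f], unfolded functional_simps[OF f]]
      show "f (\<eta> *s (X0 \<cdot> X0)) = f (\<eta> *s (2 *s X0 - (1 - \<eta>) *s (Y - al n \<cdot> Y)))"
        unfolding functional_simps[OF f] using * that by algebra
    qed
    then show ?thesis using \<eta>_neq by simp
  qed
  show "2 *s (al n \<cdot> r (n + 1)) = (if \<phi> = 0
          then (1 - 2 * \<eta>) *s (al n \<cdot> X) + \<eta> *s (al n \<cdot> Y) - (2 * \<eta>) *s al n
          else 2 *s r (n + 1) + (2 * \<eta> - 1) *s (X - al n \<cdot> X) + (1 - \<eta>) *s (Y - al n \<cdot> Y))" (is "?l = ?r")
  proof (rule eq_by_functionals)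
    fix f assume f: "functional f"
    note eqs = aXX XX XX' X
    note * = eqs[THEN arg_cong[where f=f], unfolded functional_simps[OF f]]
    show "f ?l = f ?r"
    proof (cases "\<phi> = 0")
      case True
      note ** = X11[OF this, THEN arg_cong[where f=f], unfolded functional_simps[OF f]]
      show ?thesis using True
        unfolding X1_def[symmetric] if_P[OF True] functional_simps[OF f] using *(1) ** by algebra
    next
      case False then have "\<phi> = 1" using cases_\<phi> by auto
      note ** = X00[OF this, THEN arg_cong[where f=f], unfolded functional_simps[OF f]]
      show ?thesis using \<open>\<phi> = 1\<close>
        unfolding X1_def[symmetric] if_not_P[OF False] functional_simps[OF f] using * ** by algebra
    qed
  qed
  \<comment> \<open>One square is known from \<open>X11\<close> or \<open>X00\<close>. The two
    expansions are an invertible linear system for the other two products, and \<open>pp\<close>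
    combines all three.\<close>
  show "4 *s (p \<cdot> p) = ((2 * \<eta> - 1) * \<kappa>) *s (\<kappa> *s Y + (\<kappa> - 2) *s X
            + (2 * (\<kappa> - 1)) *s al n)
          + (2 * \<kappa>) *s r n - (2 * \<kappa>\<^sup>2) *s r (n + 1) + (4 * (2 * (1 - \<eta>)\<^sup>2 - 1)) *s p" (is "?l = ?r")
  proof (rule eq_by_functionals)
    fix f assume f: "functional f"
    note 1 = trans[OF XX'[symmetric] XX, THEN arg_cong[where f=f], unfolded functional_simps[OF f]]
    note 2 = trans[OF pX'[symmetric] pX, THEN arg_cong[where f=f], unfolded functional_simps[OF f]]
    note 3 = pp[THEN arg_cong[where f=f], unfolded functional_simps[OF f]]
    note 4 = X1[folded X1_def, THEN arg_cong[where f=f], unfolded functional_simps[OF f]]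
    note 5 = X0_def[THEN arg_cong[where f=f], unfolded functional_simps[OF f]]
    note 6 = Y1[THEN arg_cong[where f=f], unfolded functional_simps[OF f]]
    from cases_\<phi> show "f ?l = f ?r"
    proof
      assume as: "\<phi> = 0 \<and> \<kappa> = \<eta>"
      then have "f (X1 \<cdot> X1) = f (2 *s X1 + \<eta> *s (al n \<cdot> Y) - (2 * \<eta>) *s al n)" using X11 by simp
      then show ?thesis using 1 2 3
        unfolding functional_simps[OF f] 4 5 6 as[THEN conjunct2] by algebra
    next
      assume as: "\<phi> = 1 \<and> \<kappa> = 1 - \<eta>"
      then have "f (X0 \<cdot> X0) = f (2 *s X0 - (1 - \<eta>) *s (Y - al n \<cdot> Y))" using X00 by simp
      then show ?thesis using 1 2 3
        unfolding functional_simps[OF f] 4 5 6 as[THEN conjunct2] by algebra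
    qed
  qed
qed

section \<open>Linear recurrence for the sequence\<close>

lemma r_prev1: "r (n - 1) = r (n + 1)"
  using r_prev[of "n + 1"] by simp

lemma mult_r_next_0: "2 *s (al n \<cdot> r (n + 1)) =
    (2 * (1 - 2 * \<eta>)) *s p + (2 * \<eta>) *s r n - (2 * \<eta>\<^sup>2) *s al n
      + ((1 - 2 * \<eta>) * \<eta>) *s (al (n + 1) + al (n - 1)) + \<eta>\<^sup>2 *s (al (n + 2) + al (n - 2))"
  if "\<phi> = 0"
  unfolding mult_r_next if_P[OF that] unfolding mult_X mult_Y
  by (rule eq_by_functionals) (simp only: functional_simps, algebra)

lemma mult_r_next_1: "2 *s (al n \<cdot> r (n + 1)) =
    2 *s r (n + 1) - (2 * (2 * \<eta> - 1)) *s p - (2 * (1 - \<eta>)) *s r n - (2 * \<eta>\<^sup>2) *s al n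
      + ((2 * \<eta> - 1) * (1 - \<eta>)) *s (al (n + 1) + al (n - 1)) + (1 - \<eta>)\<^sup>2 *s (al (n + 2) + al (n - 2))"
  if "\<phi> \<noteq> 0"
  unfolding mult_r_next if_not_P[OF that] unfolding mult_X mult_Y
  by (rule eq_by_functionals) (simp only: functional_simps, algebra)

text \<open>\<open>p_square\<close> expands the same element around \<open>n\<close> and around
  \<open>n + 1\<close>, with \<open>r n\<close> and \<open>r (n + 1)\<close> exchanged. A common
  factor \<kappa> is cancelled.\<close>

lemma r_difference: "(2 * (1 + \<kappa>)) *s (r (n + 1) - r n) = (2 * \<eta> - 1) *s
   (\<kappa> *s (al (n - 2) + al n - al (n + 1) - al (n + 3)) + 2 *s (al (n + 2) - al (n - 1)))"
  (is "?l = ?r")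
proof -
  have idx: "n + 1 + 1 = n + 2" "n + 1 + 2 = n + 3" "n + 1 - 1 = n" "n + 1 - 2 = n - 1" by auto
  have "\<kappa> *s ?l = \<kappa> *s ?r"
  proof (rule eq_by_functionals)
    fix f assume f: "functional f"
    note pp = trans[OF p_square[of n, symmetric] p_square[of "n + 1", unfolded idx r_next]]
    show "f (\<kappa> *s ?l) = f (\<kappa> *s ?r)"
      using arg_cong[OF pp, of f] unfolding functional_simps[OF f] by algebra
  qed
  then show ?thesis by (rule scale_left_imp_eq[OF \<kappa>_neq(1)])
qed

text \<open>
  \<open>H\<close> is the image of \<open>al\<close> under \<open>(1+x)(1-x\<^sup>3)\<close>, centred at \<open>n\<close>; it satisfies the recurrence
  of the remaining quadratic factor.
\<close>

definition H where "H n = al (n - 2) + al (n - 1) - al (n + 1) - al (n + 2)"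

text \<open>\<open>H n\<close> is a sum of two differences to which \<open>odd_part\<close> at
  \<open>n\<close> applies.\<close>

lemma mult_H: "al n \<cdot> H n = \<eta> *s H n"
proof -
  have idx: "2 * n - (n - 1) = n + 1" "2 * n - (n - 2) = n + 2" by auto
  show ?thesis
    using odd_part[of n "n - 1"] odd_part[of n "n - 2"] unfolding idx H_def
    by (simp add: bilinear algebra_simps)
qed

text \<open>In the sum of \<open>r_difference\<close> at \<open>n\<close> and at
  \<open>n - 1\<close> the left-hand sides cancel, because \<open>r (n - 1) = r (n + 1)\<close>. The
  factor \<open>2 * \<eta> - 1\<close> on the right is invertible.\<close>

lemma H_recurrence: "\<kappa> *s (H (n - 1) + H (n + 1)) = 2 *s H n"
proof -
  have idx: "n - 1 + 1 = n" "n - 1 + 2 = n + 1" "n - 1 - 1 = n - 2" "n - 1 - 2 = n - 3"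
   "n - 1 + 3 = n + 2" "n + 1 + 1 = n + 2" "n + 1 + 2 = n + 3" "n + 1 - 1 = n" "n + 1 - 2 = n - 1" by auto
  have "(2 * \<eta> - 1) *s (\<kappa> *s (H (n - 1) + H (n + 1))) = (2 * \<eta> - 1) *s (2 *s H n)" (is "?l = ?r")
  proof (rule eq_by_functionals)
    fix f assume f: "functional f"
    note eqs = r_difference[of n] r_difference[of "n - 1", unfolded idx r_prev1]
    note * = eqs[THEN arg_cong[where f=f], unfolded functional_simps[OF f]]
    show "f ?l = f ?r"
      using * unfolding H_def idx functional_simps[OF f] by algebra
  qed
  moreover have "2 * \<eta> - 1 \<noteq> 0" using \<eta>_neq by simp
  ultimately show ?thesis by (metis scale_left_imp_eq)
qed

text \<open>Multiplying \<open>r_difference\<close> at \<open>n\<close> and at \<open>n - 1\<close>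
  by \<open>al n\<close> yields the product of \<open>al n\<close> with
  \<open>al (n + 3) + al (n - 3)\<close>, since its products with \<open>r n\<close> and
  \<open>r (n + 1)\<close> are known. In terms of \<open>H\<close> this becomes an eigenvector
  equation.\<close>

lemma mult_H_diff: "al n \<cdot> (H (n - 1) - H (n + 1)) = \<phi> *s (H (n - 1) - H (n + 1))"
proof -
  have idx: "n - 1 + 1 = n" "n - 1 + 2 = n + 1" "n - 1 - 1 = n - 2" "n - 1 - 2 = n - 3"
   "n - 1 + 3 = n + 2" "n + 1 + 1 = n + 2" "n + 1 + 2 = n + 3" "n + 1 - 1 = n" "n + 1 - 2 = n - 1" by auto
  have "(\<kappa> * (2 * \<eta> - 1)) *s (al n \<cdot> (H (n - 1) - H (n + 1))) =
    (\<kappa> * (2 * \<eta> - 1)) *s (\<phi> *s (H (n - 1) - H (n + 1)))" (is "?l = ?r")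
  proof (rule eq_by_functionals)
    fix f assume f: "functional f"
    note 1 = r_difference[of n] r_difference[of "n - 1", unfolded idx r_prev1]
    note eqs = this this[THEN arg_cong[where f="mult (al n)"]] mult_r[of n]
    note * = eqs[THEN arg_cong[where f=f], unfolded bilinear mult_next mult_prev mult_next2 mult_prev2 idem functional_simps[OF f]]
    from cases_\<phi> show "f ?l = f ?r"
    proof
      assume as: "\<phi> = 0 \<and> \<kappa> = \<eta>"
      note ** = mult_r_next_0[OF as[THEN conjunct1], of n, THEN arg_cong[where f=f], unfolded functional_simps[OF f]]
      show ?thesis using * **
        unfolding H_def idx bilinear mult_next mult_prev mult_next2 mult_prev2 idem as[THEN conjunct1] as[THEN conjunct2]
        functional_simps[OF f] by algebra
    next
      assume as: "\<phi> = 1 \<and> \<kappa> = 1 - \<eta>"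
      then have "\<phi> \<noteq> 0" by simp
      note ** = mult_r_next_1[OF this, of n, THEN arg_cong[where f=f], unfolded functional_simps[OF f]]
      show ?thesis using * **
        unfolding H_def idx bilinear mult_next mult_prev mult_next2 mult_prev2 idem as[THEN conjunct1] as[THEN conjunct2]
        functional_simps[OF f] by algebra
    qed
  qed
  moreover have "\<kappa> * (2 * \<eta> - 1) \<noteq> 0" using \<eta>_neq \<kappa>_neq by simp
  ultimately show ?thesis by (metis scale_left_imp_eq)
qed

text \<open>\<open>mult_H_diff\<close> gives the sum of the two products and \<open>odd_part\<close>
  their difference.\<close>

lemma mult_next3: "2 *s (al n \<cdot> al (n + 3)) = \<phi> *s (H (n - 1) - H (n + 1)) + 2 *s (al n + p - r n) +
   \<eta> *s (al (n + 1) + al (n - 1) - al (n + 2) - al (n - 2) + al (n + 3) - al (n - 3))" (is "?l = ?r")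
  and mult_prev3: "2 *s (al n \<cdot> al (n - 3)) = \<phi> *s (H (n - 1) - H (n + 1)) + 2 *s (al n + p - r n) +
   \<eta> *s (al (n + 1) + al (n - 1) - al (n + 2) - al (n - 2) - al (n + 3) + al (n - 3))" (is "?l' = ?r'")
proof -
  have idx: "n - 1 + 1 = n" "n - 1 + 2 = n + 1" "n - 1 - 1 = n - 2" "n - 1 - 2 = n - 3"
   "n - 1 + 3 = n + 2" "n + 1 + 1 = n + 2" "n + 1 + 2 = n + 3" "n + 1 - 1 = n" "n + 1 - 2 = n - 1"
   "2 * n - (n + 3) = n - 3" by auto
  have "f ?l = f ?r \<and> f ?l' = f ?r'" if f: "functional f" for f
    using mult_H_diff[of n, THEN arg_cong[where f=f]] odd_part[of n "n + 3", THEN arg_cong[where f=f]]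
    unfolding H_def idx bilinear mult_next mult_prev mult_next2 mult_prev2 idem functional_simps[OF f]
    by (intro conjI) algebra+
  then show "?l = ?r" "?l' = ?r'" by (auto intro: eq_by_functionals)
qed

text \<open>Obtained by computing \<open>al n \<cdot> al (n + 3)\<close> from both ends.\<close>

lemma H_sum_first: "(4 + 2 * \<kappa> - 5 * \<kappa>\<^sup>2) *s (H (n + 1) + H (n + 2)) = 0"
proof -
  have r3: "r (n + 3) = r (n + 1)" using r_next[of "n + 1"] by (simp add: add.commute)
  have idx: "n + 3 - 3 = n" "n - 1 - 1 = n - 2" "n - 1 - 2 = n - 3" "n - 1 + 1 = n" "n - 1 + 2 = n + 1"
    "n + 1 - 1 = n" "n + 1 - 2 = n - 1" "n + 1 + 1 = n + 2" "n + 1 + 2 = n + 3"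
    "n + 2 - 1 = n + 1" "n + 2 - 2 = n" "n + 2 + 1 = n + 3" "n + 2 + 2 = n + 4"
    "n + 3 - 1 = n + 2" "n + 3 - 2 = n + 1" "n + 3 + 1 = n + 4" "n + 3 + 2 = n + 5" "n + 3 + 3 = n + 6"
    "n + 4 - 1 = n + 3" "n + 4 - 2 = n + 2" "n + 4 + 1 = n + 5" "n + 4 + 2 = n + 6" "n + 1 + 3 = n + 4" by auto
  have "\<kappa> *s ((1 + \<kappa>) *s (H (n - 1) + H (n + 1) + H (n + 2) + H (n + 4)) - 3 *s (H (n + 1) + H (n + 2))) = \<kappa> *s 0"
    (is "\<kappa> *s ?l = \<kappa> *s 0")
  proof (rule eq_by_functionals)
    fix f assume f: "functional f"
    note 1 = mult_next3[of n, unfolded mult_commute[of "al n" "al (n + 3)"]]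
      mult_prev3[of "n + 3", unfolded idx r3]
    note eqs = trans[OF 1(1)[symmetric] 1(2)] r_difference[of "n + 1", unfolded r_next idx]
    note * = this[THEN arg_cong[where f=f], unfolded H_def idx functional_simps[OF f]]
    from cases_\<phi>
    show "f (\<kappa> *s ?l) = f (\<kappa> *s 0)"
    proof
      assume as: "\<phi> = 0 \<and> \<kappa> = \<eta>"
      show ?thesis using * unfolding H_def idx functional_simps[OF f] as[THEN conjunct1] as[THEN conjunct2] by algebra
    next
      assume as: "\<phi> = 1 \<and> \<kappa> = 1 - \<eta>"
      show ?thesis using * unfolding H_def idx functional_simps[OF f] as[THEN conjunct1] as[THEN conjunct2] by algebra
    qed
  qed
  then have 1: "?l = 0" by (rule scale_left_imp_eq[OF \<kappa>_neq(1)])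
  \<comment> \<open>With \<open>2 / \<kappa>\<close> written as \<open>c\<close>, the recurrence
    turns the sum of the four terms into \<open>c * (c - 1)\<close> times
    \<open>H (n + 1) + H (n + 2)\<close>. Clearing denominators gives the coefficient.\<close>
  show ?thesis
  proof (rule eq_by_functionals)
    fix f assume f: "functional f"
    note eqs = 1 H_recurrence[of n] H_recurrence[of "n + 1"] H_recurrence[of "n + 2"] H_recurrence[of "n + 3"]
    note * = this[THEN arg_cong[where f=f], unfolded idx functional_simps[OF f]]
    show "f ((4 + 2 * \<kappa> - 5 * \<kappa>\<^sup>2) *s (H (n + 1) + H (n + 2))) = f 0"
      using * unfolding functional_simps[OF f] by algebra
  qed
qed

section \<open>Vanishing of \<open>H\<close>\<close>

definition c where "c = 2 / \<kappa>"

lemma c_\<kappa>: "c * \<kappa> = 2" using \<kappa>_neq by (simp add: c_def)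

text \<open>The method \<open>algebra\<close> does not use an equation whose right-hand side is a numeral.\<close>

lemma c_\<kappa>': "c * \<kappa> - 2 = 0" by (simp add: c_\<kappa>)

lemma H_next: "H (n + 1) = c *s H n - H (n - 1)"
proof -
  have "2 *s H (n + 1) = 2 *s (c *s H n - H (n - 1))"
  proof (rule eq_by_functionals)
    fix f assume f: "functional f"
    show "f (2 *s H (n + 1)) = f (2 *s (c *s H n - H (n - 1)))"
      using arg_cong[OF H_recurrence[of n], of f] c_\<kappa>' unfolding functional_simps[OF f] by algebra
  qed
  then show ?thesis by (rule scale_left_imp_eq[OF two_neq_0])
qed

lemma H_prev: "H (n - 1) = c *s H n - H (n + 1)"
  using H_next[of n] by simp

text \<open>With \<open>1 - 2 * \<phi>\<close> as a sign, the following products with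
  \<open>H\<close> are found for both values of \<phi> at once.\<close>

lemma \<eta>_\<kappa>: "\<eta> = \<phi> + (1 - 2 * \<phi>) * \<kappa>" "\<phi> * \<phi> = \<phi>"
  using cases_\<phi> by auto

text \<open>\<open>H (n - 1) + H (n + 1)\<close> is a multiple of \<open>H n\<close> and hence an
  \<eta>-eigenvector of \<open>al n\<close>, while the difference is a \<phi>-eigenvector.\<close>

lemma mult_H_neighbours:
  "al n \<cdot> H (n + 1) = \<phi> *s H (n + 1) + (1 - 2 * \<phi>) *s H n" (is "?l = ?r")
  "al n \<cdot> H (n - 1) = \<phi> *s H (n - 1) + (1 - 2 * \<phi>) *s H n" (is "?l' = ?r'")
proof -
  have *: "f (2 *s ?l) = f (2 *s ?r) \<and> f (2 *s ?l') = f (2 *s ?r')" if f: "functional f" for f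
    using arg_cong[OF H_prev[of n], of "\<lambda>x. f (al n \<cdot> x)"]
      arg_cong[OF H_prev[of n], of f]
      mult_H_diff[of n, THEN arg_cong[where f=f]] \<eta>_\<kappa> c_\<kappa>'
    unfolding bilinear mult_H functional_simps[OF f] by (intro conjI) algebra+
  have "2 *s ?l = 2 *s ?r" by (rule eq_by_functionals) (blast dest: *)
  moreover have "2 *s ?l' = 2 *s ?r'" by (rule eq_by_functionals) (blast dest: *)
  ultimately show "?l = ?r" "?l' = ?r'" using scale_left_imp_eq[OF two_neq_0] by blast+
qed

text \<open>The coefficient of \<open>(1 - 2 * \<phi>) *s H n\<close> in
  \<open>al n \<cdot> H (n + j)\<close> obeys the recurrence of \<open>H\<close> in
  \<open>j\<close>, with values \<kappa> and 1 at \<open>j = 0\<close> and \<open>j = 1\<close>. The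
  next ones are \<open>c - \<kappa>\<close> and, as \<open>c * \<kappa> = 2\<close>,
  \<open>c\<^sup>2 - 3\<close>.\<close>

lemma mult_H_2: "al n \<cdot> H (n + 2) = \<phi> *s H (n + 2) + ((1 - 2 * \<phi>) * (c - \<kappa>)) *s H n" (is "?l = ?r")
   "al n \<cdot> H (n - 2) = \<phi> *s H (n - 2) + ((1 - 2 * \<phi>) * (c - \<kappa>)) *s H n" (is "?l' = ?r'")
proof -
  have e: "H (n + 2) = c *s H (n + 1) - H n" using H_next[of "n + 1"] by (simp add: add.commute)
  have e': "H (n - 2) = c *s H (n - 1) - H n" using H_prev[of "n - 1"] by simp
  show "?l = ?r" unfolding e bilinear mult_H_neighbours mult_H
    by (rule eq_by_functionals) (simp only: functional_simps \<eta>_\<kappa>(1), algebra)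
  show "?l' = ?r'" unfolding e' bilinear mult_H_neighbours mult_H
    by (rule eq_by_functionals) (simp only: functional_simps \<eta>_\<kappa>(1), algebra)
qed

lemma mult_H_3: "al n \<cdot> H (n + 3) = \<phi> *s H (n + 3) + ((1 - 2 * \<phi>) * (c\<^sup>2 - 3)) *s H n" (is "?l = ?r")
   "al n \<cdot> H (n - 3) = \<phi> *s H (n - 3) + ((1 - 2 * \<phi>) * (c\<^sup>2 - 3)) *s H n" (is "?l' = ?r'")
proof -
  have e: "H (n + 3) = c *s H (n + 2) - H (n + 1)" using H_next[of "n + 2"] by (simp add: add.commute)
  have e': "H (n - 3) = c *s H (n - 2) - H (n - 1)" using H_prev[of "n - 2"] by simp
  show "?l = ?r"
  proof (rule eq_by_functionals)
    fix f assume f: "functional f"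
    show "f (?l) = f (?r)"
      using c_\<kappa>' unfolding e bilinear mult_H_neighbours mult_H_2 functional_simps[OF f] by algebra
  qed
  show "?l' = ?r'"
  proof (rule eq_by_functionals)
    fix f assume f: "functional f"
    show "f (?l') = f (?r')"
      using c_\<kappa>' unfolding e' bilinear mult_H_neighbours mult_H_2 functional_simps[OF f] by algebra
  qed
qed

text \<open>Obtained by expanding either the left or the right factor of \<open>H n \<cdot> H (n + 1)\<close>.\<close>

lemma H_sum_second: "((c\<^sup>2 - 1) * (c - 2) * (c + 1)) *s (H n + H (n + 1)) = 0" (is "?l = 0")
proof (rule eq_by_functionals)
  fix f assume f: "functional f"
  have e: "H (n + 2) = c *s H (n + 1) - H n" using H_next[of "n + 1"] by (simp add: add.commute)
  have e3: "H (n + 3) = c *s H (n + 2) - H (n + 1)" using H_next[of "n + 2"] by (simp add: add.commute)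
  have e': "H (n - 1) = c *s H n - H (n + 1)" using H_prev[of n] by simp
  have e2': "H (n - 2) = c *s H (n - 1) - H n" using H_prev[of "n - 1"] by simp
  have idx: "n + 1 - 1 = n" "n + 1 - 2 = n - 1" "n + 1 + 1 = n + 2" "n + 1 + 2 = n + 3"
    "n - 1 + 1 = n" "n - 1 + 2 = n + 1" "n - 2 + 3 = n + 1" "n - 2 + 2 = n" "n + 2 - 2 = n" "n + 2 - 1 = n + 1" "n + 3 - 3 = n" by auto
  note m1 = mult_H_3(1)[of "n - 2", unfolded idx] mult_H_2(1)[of "n - 1", unfolded idx] mult_H[of "n + 1"]
    mult_H_neighbours(2)[of "n + 2", unfolded idx]
  note m2 = mult_H_3(2)[of "n + 3", unfolded idx] mult_H_2(2)[of "n + 2", unfolded idx] mult_H[of n]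
    mult_H_neighbours(1)[of "n - 1", unfolded idx]
  have "H n \<cdot> H (n + 1) = (al (n - 2) + al (n - 1) - al (n + 1) - al (n + 2)) \<cdot> H (n + 1)"
    by (simp add: H_def[of n])
  also have "\<dots> = (1 - 2 * \<phi>) *s ((c\<^sup>2 - 3) *s H (n - 2) + (c - \<kappa>) *s H (n - 1) - \<kappa> *s H (n + 1) - H (n + 2))"
    unfolding bilinear m1
    by (rule eq_by_functionals) (simp only: functional_simps \<eta>_\<kappa>(1), algebra)
  finally have A: "H n \<cdot> H (n + 1) = \<dots>" .
  have "H n \<cdot> H (n + 1) = (al (n - 1) + al n - al (n + 2) - al (n + 3)) \<cdot> H n"
    using mult_commute[of "H n" "H (n + 1)"] unfolding H_def[of "n + 1"] idx by simp
  also have "\<dots> = (1 - 2 * \<phi>) *s (H (n - 1) + \<kappa> *s H n - (c - \<kappa>) *s H (n + 2) - (c\<^sup>2 - 3) *s H (n + 3))"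
    unfolding bilinear m2
    by (rule eq_by_functionals) (simp only: functional_simps \<eta>_\<kappa>(1), algebra)
  finally have B: "H n \<cdot> H (n + 1) = \<dots>" .
  \<comment> \<open>The \<phi>-multiples have cancelled within each expansion. Once everything is
    reduced to \<open>H n\<close> and \<open>H (n + 1)\<close>, both get the same coefficient in the
    difference.\<close>
  note C = trans[OF A[symmetric] B, THEN arg_cong[where f=f]]
  from cases_\<phi> show "f ?l = f 0"
    using C c_\<kappa>' unfolding e3 e2' unfolding e e' functional_simps[OF f] by (elim disjE conjE; simp only:; algebra)
qed

text \<open>The factor in \<open>H_sum_second\<close> vanishes only for \<open>c = 1\<close> or
  \<open>c = -1\<close>, since \<open>c = 2\<close> would mean \<kappa> = 1. Then \<kappa> is 2 or
  -2 and the factor in \<open>H_sum_first\<close> is -12 or -20; here 3 or 5, respectively, is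
  nonzero because \<open>2 * \<kappa>\<close> is not 1.\<close>

lemma H_sum: "H n + H (n + 1) = 0"
proof (cases "(c\<^sup>2 - 1) * (c - 2) * (c + 1) = 0")
  case False
  then show ?thesis using H_sum_second[of n] by simp
next
  case True
  have "c \<noteq> 2" using c_\<kappa> \<kappa>_neq(2) two_neq_0 by auto
  with True have "c = 1 \<or> c = - 1" by (auto simp: power2_eq_1_iff eq_neg_iff_add_eq_0)
  then have "4 + 2 * \<kappa> - 5 * \<kappa>\<^sup>2 \<noteq> 0"
  proof
    assume "c = 1"
    then have \<kappa>: "\<kappa> = 2" using c_\<kappa> by simp
    have "2 * \<kappa> = 3 + 1" using \<kappa> by simp
    then have "(3::'f) \<noteq> 0" using \<kappa>_neq(3) by (metis add_0)
    have "4 + 2 * \<kappa> - 5 * \<kappa>\<^sup>2 = - (2 * 2 * 3)" unfolding \<kappa> by simp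
    then show ?thesis using \<open>(3::'f) \<noteq> 0\<close> two_neq_0 by (metis mult_eq_0_iff neg_equal_0_iff_equal)
  next
    assume "c = - 1"
    then have "- \<kappa> = 2" using c_\<kappa> by simp
    then have \<kappa>: "\<kappa> = - 2" by (metis minus_minus)
    have "2 * \<kappa> = 1 - 5" using \<kappa> by simp
    then have "(5::'f) \<noteq> 0" using \<kappa>_neq(3) by (metis diff_zero)
    have "4 + 2 * \<kappa> - 5 * \<kappa>\<^sup>2 = - (2 * 2 * 5)" unfolding \<kappa> by simp
    then show ?thesis using \<open>(5::'f) \<noteq> 0\<close> two_neq_0 by (metis mult_eq_0_iff neg_equal_0_iff_equal)
  qed
  then show ?thesis using H_sum_first[of "n - 1"] by (simp add: add.commute)
qed

text \<open>By \<open>H_sum\<close>, \<open>H\<close> alternates in sign, which turns the recurrence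
  into \<open>(2 * (\<kappa> + 1)) *s H n = 0\<close>. Only \<kappa> = -1 needs another
  argument.\<close>

lemma H_zero: "H n = 0"
proof (cases "\<kappa> = - 1")
  case False
  have "(2 * (\<kappa> + 1)) *s H n = 0"
  proof (rule eq_by_functionals)
    fix f assume f: "functional f"
    have "n - 1 + 1 = n" by simp
    note eqs = H_sum[of n] H_sum[of "n - 1", unfolded this] H_recurrence[of n]
    note * = eqs[THEN arg_cong[where f=f], unfolded functional_simps[OF f]]
    show "f ((2 * (\<kappa> + 1)) *s H n) = f 0"
      using * unfolding functional_simps[OF f] by algebra
  qed
  moreover have "2 * (\<kappa> + 1) \<noteq> 0"
    using False two_neq_0 by (simp add: eq_neg_iff_add_eq_0 del: distrib_left_numeral)
  ultimately show ?thesis unfolding scale_eq_0_iff by blast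
next
  case True
  \<comment> \<open>Here \<open>H\<close> alternates in sign; multiplying \<open>H n + H (n + 1) = 0\<close> by \<open>r n\<close> yields \<open>36 *s H n = 0\<close>.\<close>
  have idx: "n - 2 - 1 = n - 3" "n - 2 - 2 = n - 4" "n - 2 + 1 = n - 1" "n - 2 + 2 = n" "n - 2 + 3 = n + 1"
    "n - 1 - 1 = n - 2" "n - 1 - 2 = n - 3" "n - 1 + 1 = n" "n - 1 + 2 = n + 1"
    "n + 1 - 1 = n" "n + 1 - 2 = n - 1" "n + 1 + 1 = n + 2" "n + 1 + 2 = n + 3"
    "n + 2 - 1 = n + 1" "n + 2 - 2 = n" "n + 2 + 1 = n + 3" "n + 2 + 2 = n + 4"
    "n + 3 - 1 = n + 2" "n + 3 - 2 = n + 1" "n + 3 + 1 = n + 4" "n + 3 + 2 = n + 5" by auto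
  have r: "r (n + 3) = r (n + 1)" "r (n + 4) = r n"
    using r_next[of "n + 1"] r_next[of "n + 2"] r_next[of n] by (simp_all add: add.commute)
  have h: "H (n + 1) = - H n" "H (n + 2) = H n" "H (n + 3) = - H n" "H (n - 1) = - H n" "H (n - 2) = H n"
  proof -
    have neg: "H (k + 1) = - H k" for k using H_sum[of k] by (simp add: add_eq_0_iff)
    show "H (n + 1) = - H n" "H (n + 2) = H n" "H (n + 3) = - H n" "H (n - 1) = - H n" "H (n - 2) = H n"
      using neg[of n] neg[of "n + 1"] neg[of "n + 2"] neg[of "n - 1"] neg[of "n - 2"] unfolding idx by simp_all
  qed
  \<comment> \<open>These equations express \<open>al (n - 4)\<close> to \<open>al (n + 5)\<close>
    by the four middle terms \<open>al (n - 1)\<close> to \<open>al (n + 2)\<close> and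
    \<open>H n\<close>.\<close>
  have a: "al (n + 3) = al (n - 1) + al n - al (n + 2) + H n"
    "al (n - 2) = al (n + 1) + al (n + 2) - al (n - 1) + H n"
    using h(1) unfolding H_def[of "n + 1"] idx by (simp_all add: H_def[of n] algebra_simps)
  have a4: "al (n + 4) = al n + al (n + 1) - al (n + 3) - H n"
    using h(2) unfolding H_def[of "n + 2"] idx by (simp add: algebra_simps)
  have a5: "al (n + 5) = al (n + 1) + al (n + 2) - al (n + 4) + H n"
    using h(3) unfolding H_def[of "n + 3"] idx by (simp add: algebra_simps)
  have a3': "al (n - 3) = al n + al (n + 1) - al (n - 2) - H n"
    using h(4) unfolding H_def[of "n - 1"] idx by (simp add: algebra_simps)
  have a4': "al (n - 4) = al (n - 1) + al n - al (n - 3) + H n"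
    using h(5) unfolding H_def[of "n - 2"] idx by (simp add: algebra_simps)
  have "36 *s H n = 0"
  proof (rule eq_by_functionals)
    fix f assume f: "functional f"
    have "r n \<cdot> H n + r n \<cdot> H (n + 1) = 0"
      using H_sum[of n] by (simp flip: mult_add_right)
    from this[THEN arg_cong[where f="\<lambda>x. f (2 *s x)"]]
    have 1: "f (2 *s (al (n - 2) \<cdot> r n)) + 2 * f (2 *s (al (n - 1) \<cdot> r n)) + f (2 *s (al n \<cdot> r n))
      - f (2 *s (al (n + 1) \<cdot> r n)) - 2 * f (2 *s (al (n + 2) \<cdot> r n)) - f (2 *s (al (n + 3) \<cdot> r n)) = 0"
      unfolding H_def idx bilinear mult_commute[of "r n"] functional_simps[OF f] by algebra
    note 5 = mult_r[of "n - 2", unfolded idx r_prev] mult_r[of n] mult_r[of "n + 2", unfolded idx r_next]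
    from cases_\<phi> show "f (36 *s H n) = f 0"
    proof
      assume as: "\<phi> = 0 \<and> \<kappa> = \<eta>"
      then have e: "\<eta> = - 1" using True by simp
      note m = mult_r_next_0[OF as[THEN conjunct1]]
      note 7 = m[of "n - 1", unfolded idx r_prev1] m[of "n + 1", unfolded idx r_next] m[of "n + 3", unfolded idx r]
      show ?thesis using 1 unfolding 5 7 unfolding a5 a4' unfolding a4 a3' unfolding a e functional_simps[OF f] by algebra
    next
      assume as: "\<phi> = 1 \<and> \<kappa> = 1 - \<eta>"
      then have nz: "\<phi> \<noteq> 0" by simp
      have "\<eta> = 1 - \<kappa>" using as by simp
      then have e: "\<eta> = 2" using True by simp
      note m = mult_r_next_1[OF nz]
      note 7 = m[of "n - 1", unfolded idx r_prev1] m[of "n + 1", unfolded idx r_next] m[of "n + 3", unfolded idx r]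
      show ?thesis using 1 unfolding 5 7 unfolding a5 a4' unfolding a4 a3' unfolding a e functional_simps[OF f] by algebra
    qed
  qed
  \<comment> \<open>If 3 were zero, then \<open>2 * \<kappa> = -2\<close> would equal 1.\<close>
  moreover have "(36::'f) \<noteq> 0"
  proof -
    have "2 * \<kappa> = 1 - 3" using True by simp
    then have "(3::'f) \<noteq> 0" using \<kappa>_neq(3) by (metis diff_zero)
    moreover have "(36::'f) = 2 * 2 * (3 * 3)" by simp
    ultimately show ?thesis using two_neq_0 by (metis mult_eq_0_iff)
  qed
  ultimately show ?thesis by simp
qed

section \<open>Splitting off two orthogonal idempotents\<close>

definition \<delta> where "\<delta> = al 2 - al (-1)"
definition s0 where "s0 = al 0 \<cdot> \<delta>"
definition s1 where "s1 = - (al 1 \<cdot> \<delta>)"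

text \<open>Each equation \<open>H n = 0\<close> yields one further term. Terms at distance three
  differ by \<delta> with alternating sign, so \<delta> measures the failure of period
  three.\<close>

lemma al_neighbours: "al (-1) = al 2 - \<delta>" "al 3 = al 0 - \<delta>" "al (-2) = al 1 + \<delta>" "al (-3) = al 0 - \<delta>"
  "al 4 = al 1 + \<delta>" "al 5 = al 2 - \<delta>" "al 6 = al 0"
proof -
  show m1: "al (-1) = al 2 - \<delta>" by (simp add: \<delta>_def)
  show m2: "al (-2) = al 1 + \<delta>" using H_zero[of 0] by (simp add: H_def m1 algebra_simps)
  show "al (-3) = al 0 - \<delta>" using H_zero[of "-1"] by (simp add: H_def m2 algebra_simps)
  show 3: "al 3 = al 0 - \<delta>" using H_zero[of 1] by (simp add: H_def m1 algebra_simps)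
  show 4: "al 4 = al 1 + \<delta>" using H_zero[of 2] by (simp add: H_def 3 algebra_simps)
  show 5: "al 5 = al 2 - \<delta>" using H_zero[of 3] by (simp add: H_def 4 algebra_simps)
  show "al 6 = al 0" using H_zero[of 4] by (simp add: H_def 3 5 algebra_simps)
qed

text \<open>The product \<open>al 0 \<cdot> al 3\<close> is computed from both ends, now with
  \<open>H\<close> zero. In contrast to \<open>r_difference\<close>, no factor
  \<open>1 + \<kappa>\<close> has to be cancelled, so \<kappa> = -1 is covered.\<close>

lemma r_difference_\<delta>: "r 0 - r 1 = (1 - 2 * \<eta>) *s \<delta>"
proof -
  have "2 *s (r 0 - r 1) = 2 *s ((1 - 2 * \<eta>) *s \<delta>)"
  proof (rule eq_by_functionals)
    fix f assume f: "functional f"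
    have r: "r 3 = r 1" using r_next[of 1] by simp
    have "2 *s (al 0 + p - r 0) + \<eta> *s (al 1 + al (-1) - al 2 - al (-2) + al 3 - al (-3)) =
       2 *s (al 3 + p - r 1) + \<eta> *s (al 4 + al 2 - al 5 - al 1 - al 6 + al 0)"
      using mult_next3[of 0] mult_prev3[of 3] mult_commute[of "al 0" "al 3"] by (simp add: H_zero r)
    from arg_cong[OF this, of f] show "f (2 *s (r 0 - r 1)) = f (2 *s ((1 - 2 * \<eta>) *s \<delta>))"
      unfolding al_neighbours functional_simps[OF f] by algebra
  qed
  then show ?thesis by (rule scale_left_imp_eq[OF two_neq_0])
qed

lemma s_eq: "s0 = r 0 - p + \<eta> *s \<delta>" "s1 = r 1 - p - \<eta> *s \<delta>"
proof -
  have "al 0 \<cdot> \<delta> = al 0 \<cdot> al 2 - al 0 \<cdot> al (-1)" by (simp add: \<delta>_def bilinear)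
  then show "s0 = r 0 - p + \<eta> *s \<delta>"
    using mult_next2[of 0] mult_prev[of 0] by (simp add: s0_def \<delta>_def algebra_simps)
  have "al 1 \<cdot> \<delta> = al 1 \<cdot> al 2 - al 1 \<cdot> al (-1)" by (simp add: \<delta>_def bilinear)
  then show "s1 = r 1 - p - \<eta> *s \<delta>"
    using mult_next[of 1] mult_prev2[of 1] by (simp add: s1_def \<delta>_def algebra_simps)
qed

lemma \<delta>_eq: "\<delta> = s0 - s1"
proof (rule eq_by_functionals)
  fix f assume f: "functional f"
  show "f \<delta> = f (s0 - s1)"
    using arg_cong[OF r_difference_\<delta>, of f] unfolding s_eq functional_simps[OF f] by algebra
qed

text \<open>For \<open>al 2\<close> and \<open>al (-1)\<close>, \<delta> is written as
  \<open>al 0 - al 3\<close> and \<open>al (-2) - al 1\<close>, so that only products at distance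
  one and two occur.\<close>

lemma al_\<delta>: "al 0 \<cdot> \<delta> = s0" "al 1 \<cdot> \<delta> = - s1" "al 2 \<cdot> \<delta> = s0" "al (-1) \<cdot> \<delta> = - s1"
proof -
  show "al 0 \<cdot> \<delta> = s0" "al 1 \<cdot> \<delta> = - s1" by (simp_all add: s0_def s1_def)
  have "al 2 \<cdot> \<delta> = al 2 \<cdot> al 0 - al 2 \<cdot> al 3" by (simp add: al_neighbours bilinear)
  also have "\<dots> = (r 0 + \<eta> *s (al 2 + al 0)) - (p + \<eta> *s (al 2 + al 3))"
    using mult_prev2[of 2] mult_next[of 2] r_next[of 0] by simp
  finally show "al 2 \<cdot> \<delta> = s0" by (simp add: s_eq al_neighbours algebra_simps)
  have "al (-1) \<cdot> \<delta> = al (-1) \<cdot> al (-2) - al (-1) \<cdot> al 1" by (simp add: al_neighbours(3) bilinear)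
  then show "al (-1) \<cdot> \<delta> = - s1"
    using mult_prev[of "-1"] mult_next2[of "-1"] r_next[of "-1"]
    by (simp add: s_eq al_neighbours(3) algebra_simps)
qed

text \<open>\<open>s_eq\<close> expresses \<open>s0\<close> and \<open>s1\<close> by elements whose
  products with \<open>al n\<close> are known. The zero products then follow from
  \<open>\<delta> = s0 - s1\<close>.\<close>

lemma al_s: "al 0 \<cdot> s0 = s0" "al 1 \<cdot> s1 = s1" "al 2 \<cdot> s0 = s0" "al (-1) \<cdot> s1 = s1"
   "al 0 \<cdot> s1 = 0" "al 1 \<cdot> s0 = 0" "al 2 \<cdot> s1 = 0" "al (-1) \<cdot> s0 = 0"
proof -
  have r2: "r 2 = r 0" "r (-1) = r 1" using r_next[of 0] r_next[of "-1"] by auto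
  have s0: "al n \<cdot> s0 = s0" if "al n \<cdot> \<delta> = s0" "r n = r 0"
    "al (n + 2) + al (n - 2) - (al (n + 1) + al (n - 1)) = 2 *s \<delta>" for n
  proof -
    have "2 *s (al n \<cdot> s0) = 2 *s s0"
    proof (rule eq_by_functionals)
      fix f assume f: "functional f"
      note eqs = that(1,3) mult_r[of n, unfolded that(2)] mult_p[of n] s_eq(1)
      note * = this[THEN arg_cong[where f=f], unfolded functional_simps[OF f]]
      have "2 *s (al n \<cdot> s0) = 2 *s (al n \<cdot> r 0) - 2 *s (al n \<cdot> p) + (2 * \<eta>) *s (al n \<cdot> \<delta>)"
        unfolding s_eq(1) bilinear by (simp add: algebra_simps)
      from arg_cong[OF this, of f] show "f (2 *s (al n \<cdot> s0)) = f (2 *s s0)"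
        using * unfolding functional_simps[OF f] by algebra
    qed
    then show ?thesis by (rule scale_left_imp_eq[OF two_neq_0])
  qed
  have s1: "al n \<cdot> s1 = s1" if "al n \<cdot> \<delta> = - s1" "r n = r 1"
    "al (n + 2) + al (n - 2) - (al (n + 1) + al (n - 1)) = - (2 *s \<delta>)" for n
  proof -
    have "2 *s (al n \<cdot> s1) = 2 *s s1"
    proof (rule eq_by_functionals)
      fix f assume f: "functional f"
      note eqs = that(1,3) mult_r[of n, unfolded that(2)] mult_p[of n] s_eq(2)
      note * = this[THEN arg_cong[where f=f], unfolded functional_simps[OF f]]
      have "2 *s (al n \<cdot> s1) = 2 *s (al n \<cdot> r 1) - 2 *s (al n \<cdot> p) - (2 * \<eta>) *s (al n \<cdot> \<delta>)"
        unfolding s_eq(2) bilinear by (simp add: algebra_simps)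
      from arg_cong[OF this, of f] show "f (2 *s (al n \<cdot> s1)) = f (2 *s s1)"
        using * unfolding functional_simps[OF f] by algebra
    qed
    then show ?thesis by (rule scale_left_imp_eq[OF two_neq_0])
  qed
  have two: "2 *s x = x + x" for x by (metis one_add_one scale_left_distrib scale_one)
  show 0: "al 0 \<cdot> s0 = s0" by (rule s0) (simp_all add: al_\<delta> al_neighbours two)
  show 2: "al 2 \<cdot> s0 = s0" by (rule s0) (simp_all add: al_\<delta> al_neighbours two r2)
  show 1: "al 1 \<cdot> s1 = s1" by (rule s1) (simp_all add: al_\<delta> al_neighbours two)
  show m1: "al (-1) \<cdot> s1 = s1"
    by (rule s1) (simp_all add: al_\<delta>, simp_all add: al_neighbours two r2)
  have s1': "s1 = s0 - \<delta>" and s0': "s0 = s1 + \<delta>" by (simp_all add: \<delta>_eq)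
  show "al 0 \<cdot> s1 = 0" "al 2 \<cdot> s1 = 0" unfolding s1' by (simp_all add: bilinear 0 2 al_\<delta>)
  show "al 1 \<cdot> s0 = 0" "al (-1) \<cdot> s0 = 0" unfolding s0' by (simp_all add: bilinear 1 m1 al_\<delta>)
qed

text \<open>Multiplying \<open>s0\<close> and \<open>s1\<close> by \<delta> gives their squares up
  to the common error \<open>s0 \<cdot> s1\<close>. Since \<open>s0\<close> and \<open>s1\<close>
  are a 1- and a 0-eigenvector of \<open>al 0\<close>, applying \<open>al 0\<close> to one of these
  squares shows that the error is zero.\<close>

lemma s_s: "s0 \<cdot> s0 = s0" "s1 \<cdot> s1 = s1" "s0 \<cdot> s1 = 0"
proof -
  have d: "\<delta> \<cdot> s0 = s0" "\<delta> \<cdot> s1 = - s1"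
    unfolding \<delta>_def by (simp_all add: bilinear al_s)
  have e: "s0 \<cdot> s0 = s0 + s0 \<cdot> s1" "s1 \<cdot> s1 = s1 + s0 \<cdot> s1"
    using d unfolding \<delta>_eq bilinear by (simp_all add: mult_commute[of s1 s0] algebra_simps)
  have f01: "al 0 \<cdot> (s0 \<cdot> s1) = \<phi> *s (s0 \<cdot> s1)"
    using fusion_01[of 0 s1 s0] by (simp add: al_s mult_commute[of s1 s0])
  from cases_\<phi> show "s0 \<cdot> s1 = 0"
  proof
    assume "\<phi> = 0 \<and> \<kappa> = \<eta>"
    moreover have "al 0 \<cdot> (s0 \<cdot> s0) = s0 \<cdot> s0" using al_s by (intro fusion_11)
    ultimately show ?thesis using f01 unfolding e(1) by (simp add: bilinear al_s)
  next
    assume "\<phi> = 1 \<and> \<kappa> = 1 - \<eta>"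
    moreover have "al 0 \<cdot> (s1 \<cdot> s1) = 0" using al_s by (intro fusion_00)
    ultimately show ?thesis using f01 unfolding e(2) by (simp add: bilinear al_s)
  qed
  then show "s0 \<cdot> s0 = s0" "s1 \<cdot> s1 = s1" using e by auto
qed

text \<open>By the fusion rule, \<open>p \<cdot> s0 + \<eta> *s s0\<close> is a 1-eigenvector and
  \<open>p \<cdot> s1 + \<eta> *s s1\<close> a 0-eigenvector of \<open>al 0\<close>. They are equal
  because \<open>p \<cdot> \<delta> = - (\<eta> *s \<delta>)\<close>, so both vanish.\<close>

lemma p_s: "p \<cdot> s0 = - (\<eta> *s s0)" "p \<cdot> s1 = - (\<eta> *s s1)"
proof -
  define X where "X = al 1 + al (-1)"
  have X1: "al 0 \<cdot> X = 2 *s p + (2 * \<eta>) *s al 0 + \<eta> *s X"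
    using mult_X[of 0] by (simp add: X_def)
  define X1 where "X1 = al 0 \<cdot> X"
  have e1: "al 0 \<cdot> X1 = X1" and e0: "al 0 \<cdot> (X - X1) = 0"
    using even_part[of 0 1] unfolding X1_def X_def by (simp_all add: bilinear)
  have "al 0 \<cdot> (X1 \<cdot> s0) = X1 \<cdot> s0" "al 0 \<cdot> ((X - X1) \<cdot> s1) = 0"
    using fusion_11[OF e1, of s0] fusion_00[OF e0, of s1] al_s by auto
  moreover have "X1 \<cdot> s0 = 2 *s (p \<cdot> s0 + \<eta> *s s0)" "(X - X1) \<cdot> s1 = 2 *s s1 - 2 *s (p \<cdot> s1 + \<eta> *s s1)"
  proof -
    have 1: "X \<cdot> s0 = 0" by (simp add: X_def bilinear al_s)
    have 2: "X \<cdot> s1 = 2 *s s1" unfolding X_def bilinear al_s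
      by (metis one_add_one scale_left_distrib scale_one)
    show "X1 \<cdot> s0 = 2 *s (p \<cdot> s0 + \<eta> *s s0)"
      unfolding X1_def X1 bilinear 1 al_s by (simp add: algebra_simps)
    show "(X - X1) \<cdot> s1 = 2 *s s1 - 2 *s (p \<cdot> s1 + \<eta> *s s1)"
      unfolding X1_def X1 bilinear 2 al_s by (simp add: algebra_simps)
  qed
  ultimately have 0: "al 0 \<cdot> (p \<cdot> s0 + \<eta> *s s0) = p \<cdot> s0 + \<eta> *s s0" "al 0 \<cdot> (p \<cdot> s1 + \<eta> *s s1) = 0"
    using two_neq_0 by (simp_all add: mult_scale_right mult_diff_right al_s)
  have "2 *s (p \<cdot> \<delta>) = 2 *s (- (\<eta> *s \<delta>))"
  proof (rule eq_by_functionals)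
    fix f assume f: "functional f"
    have "2 *s (p \<cdot> \<delta>) = 2 *s (al 2 \<cdot> p) - 2 *s (al (-1) \<cdot> p)"
      unfolding \<delta>_def by (simp add: bilinear mult_commute[of p] algebra_simps)
    from arg_cong[OF this[unfolded mult_p, simplified], of f]
    show "f (2 *s (p \<cdot> \<delta>)) = f (2 *s (- (\<eta> *s \<delta>)))"
      unfolding al_neighbours functional_simps[OF f] by algebra
  qed
  then have "p \<cdot> \<delta> = - (\<eta> *s \<delta>)" by (rule scale_left_imp_eq[OF two_neq_0])
  then have "p \<cdot> s0 + \<eta> *s s0 = p \<cdot> s1 + \<eta> *s s1"
    unfolding \<delta>_eq bilinear by (simp add: algebra_simps)
  with 0 have "p \<cdot> s0 + \<eta> *s s0 = 0" "p \<cdot> s1 + \<eta> *s s1 = 0" by auto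
  then show "p \<cdot> s0 = - (\<eta> *s s0)" "p \<cdot> s1 = - (\<eta> *s s1)"
    by (auto simp: eq_neg_iff_add_eq_0)
qed

lemma relations:
  obtains A0 A1 A2 q s0 s1 where "al 0 = A0 + s0" "al 1 = A1 + s1"
    "hat_3C_relations scale mult \<eta> A0 A1 A2 q s0 s1"
proof -
  define A0 A1 A2 where "A0 = al 0 - s0" and "A1 = al 1 - s1" and "A2 = al 2 - s0"
  \<comment> \<open>All three products of distinct \<open>A0\<close>, \<open>A1\<close>,
    \<open>A2\<close> are \<open>p + \<eta> *s (s0 + s1)\<close> plus \<eta> times the sum of the
    factors; \<open>q\<close> is what the first relation of \<open>A_mult\<close> then
    requires.\<close>
  define q where "q = (1 - \<eta>) *s (A0 + A1 + A2) - 2 *s (p + \<eta> *s (s0 + s1))"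
  have r: "r 0 = s0 + p - \<eta> *s (s0 - s1)" "r 1 = s1 + p + \<eta> *s (s0 - s1)"
    unfolding \<delta>_eq[symmetric] by (simp_all add: s_eq)
  have al: "al (-1) = al 2 - (s0 - s1)" "al 3 = al 0 - (s0 - s1)" "al (-2) = al 1 + (s0 - s1)"
    by (simp_all only: al_neighbours \<delta>_eq)
  have aa: "al 0 \<cdot> al 1 = p + \<eta> *s (al 0 + al 1)" "al 1 \<cdot> al 2 = p + \<eta> *s (al 1 + al 2)"
     "al 0 \<cdot> al 2 = r 0 + \<eta> *s (al 0 + al 2)"
    using mult_next[of 0] mult_next[of 1] mult_next2[of 0] by simp_all
  have pa: "2 *s (p \<cdot> al 0) = (2 * (1 - \<eta>)) *s p - (2 * \<eta>\<^sup>2) *s al 0 + (\<eta> * (1 - \<eta>)) *s (al 1 + al (-1))"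
    "2 *s (p \<cdot> al 1) = (2 * (1 - \<eta>)) *s p - (2 * \<eta>\<^sup>2) *s al 1 + (\<eta> * (1 - \<eta>)) *s (al 2 + al 0)"
    "2 *s (p \<cdot> al 2) = (2 * (1 - \<eta>)) *s p - (2 * \<eta>\<^sup>2) *s al 2 + (\<eta> * (1 - \<eta>)) *s (al 3 + al 1)"
    using mult_p[of 0] mult_p[of 1] mult_p[of 2] by (simp_all add: mult_commute[of p])
  have pp: "4 *s (p \<cdot> p) = ((2 * \<eta> - 1) * \<kappa>) *s (\<kappa> *s (al 2 + al (-2)) + (\<kappa> - 2) *s (al 1 + al (-1))
            + (2 * (\<kappa> - 1)) *s al 0)
          + (2 * \<kappa>) *s r 0 - (2 * \<kappa>\<^sup>2) *s r 1 + (4 * (2 * (1 - \<eta>)\<^sup>2 - 1)) *s p"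
    using p_square[of 0] by simp
  have sa: "s0 \<cdot> al 0 = s0" "s0 \<cdot> al 1 = 0" "s0 \<cdot> al 2 = s0" "s1 \<cdot> al 0 = 0" "s1 \<cdot> al 1 = s1" "s1 \<cdot> al 2 = 0"
    "s0 \<cdot> p = - (\<eta> *s s0)" "s1 \<cdot> p = - (\<eta> *s s1)" "s1 \<cdot> s0 = 0"
    using al_s p_s s_s by (simp_all add: mult_commute)
  have sA: "s0 \<cdot> A0 = 0" "s0 \<cdot> A1 = 0" "s0 \<cdot> A2 = 0" "s1 \<cdot> A0 = 0" "s1 \<cdot> A1 = 0" "s1 \<cdot> A2 = 0"
    unfolding A0_def A1_def A2_def bilinear sa s_s by simp_all
  have As: "A0 \<cdot> s0 = 0" "A1 \<cdot> s0 = 0" "A2 \<cdot> s0 = 0" "A0 \<cdot> s1 = 0" "A1 \<cdot> s1 = 0" "A2 \<cdot> s1 = 0"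
    using sA by (simp_all add: mult_commute)
  have sq: "s0 \<cdot> q = 0" "s1 \<cdot> q = 0"
    unfolding q_def bilinear sA sa s_s by simp_all
  have i: "A0 \<cdot> A0 = A0" "A1 \<cdot> A1 = A1" "A2 \<cdot> A2 = A2"
    unfolding A0_def A1_def A2_def bilinear idem sa al_s s_s by simp_all
  have AA: "A0 \<cdot> A1 = p + \<eta> *s (s0 + s1 + A0 + A1)" "A0 \<cdot> A2 = p + \<eta> *s (s0 + s1 + A0 + A2)"
    "A1 \<cdot> A2 = p + \<eta> *s (s0 + s1 + A1 + A2)"
    unfolding A0_def A1_def A2_def bilinear aa al_s sa s_s r
    by (rule eq_by_functionals, simp only: functional_simps, algebra)+
  have A01: "2 *s (A0 \<cdot> A1) = (\<eta> + 1) *s (A0 + A1) + (1 - \<eta>) *s A2 - q"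
    and A02: "2 *s (A0 \<cdot> A2) = (\<eta> + 1) *s (A0 + A2) + (1 - \<eta>) *s A1 - q"
    and A12: "2 *s (A1 \<cdot> A2) = (\<eta> + 1) *s (A1 + A2) + (1 - \<eta>) *s A0 - q"
    unfolding q_def AA by (rule eq_by_functionals, simp only: functional_simps, algebra)+
  have pA: "2 *s (p \<cdot> A0) = (2 * (1 - \<eta>)) *s p - (2 * \<eta>\<^sup>2) *s A0 + (\<eta> * (1 - \<eta>)) *s (A1 + A2)
       + (2 * \<eta> * (1 - \<eta>)) *s (s0 + s1)"
    "2 *s (p \<cdot> A1) = (2 * (1 - \<eta>)) *s p - (2 * \<eta>\<^sup>2) *s A1 + (\<eta> * (1 - \<eta>)) *s (A0 + A2)
       + (2 * \<eta> * (1 - \<eta>)) *s (s0 + s1)"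
    "2 *s (p \<cdot> A2) = (2 * (1 - \<eta>)) *s p - (2 * \<eta>\<^sup>2) *s A2 + (\<eta> * (1 - \<eta>)) *s (A0 + A1)
       + (2 * \<eta> * (1 - \<eta>)) *s (s0 + s1)"
    unfolding A0_def A1_def A2_def mult_diff_right scale_right_diff_distrib pa p_s al
    by (rule eq_by_functionals, simp only: functional_simps, algebra)+
  have q: "q \<cdot> x = (1 - \<eta>) *s (x \<cdot> (A0 + A1 + A2)) - 2 *s (p \<cdot> x)"
    if "x \<cdot> s0 = 0" "x \<cdot> s1 = 0" for x
    unfolding q_def using that
    by (simp add: bilinear mult_commute[of _ x] algebra_simps)
  have qA: "q \<cdot> A0 = (\<eta> + 1) *s A0" "q \<cdot> A1 = (\<eta> + 1) *s A1" "q \<cdot> A2 = (\<eta> + 1) *s A2"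
  proof -
    have sym: "A1 \<cdot> A0 = A0 \<cdot> A1" "A2 \<cdot> A0 = A0 \<cdot> A2" "A2 \<cdot> A1 = A1 \<cdot> A2"
      by (simp_all add: mult_commute)
    show "q \<cdot> A0 = (\<eta> + 1) *s A0" "q \<cdot> A1 = (\<eta> + 1) *s A1" "q \<cdot> A2 = (\<eta> + 1) *s A2"
      unfolding q[OF As(1) As(4)] q[OF As(2) As(5)] q[OF As(3) As(6)] pA bilinear i sym AA
      by (rule eq_by_functionals, simp only: functional_simps, algebra)+
  qed
  \<comment> \<open>Expanding \<open>q\<close> reduces this to \<open>p \<cdot> p\<close>, which
    \<open>p_square\<close> supplies.\<close>
  have "4 *s (q \<cdot> q) = 4 *s ((\<eta> + 1) *s q)"
  proof (rule eq_by_functionals)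
    fix f assume f: "functional f"
    have qs: "q \<cdot> s0 = 0" "q \<cdot> s1 = 0" using sq by (simp_all add: mult_commute)
    have q1: "q \<cdot> q = ((1 - \<eta>) * (\<eta> + 1)) *s (A0 + A1 + A2) - 2 *s (q \<cdot> p)"
      unfolding q[OF qs] bilinear qA mult_commute[of p] by (simp add: algebra_simps)
    have q2: "2 *s (q \<cdot> p) = (1 - \<eta>) *s (2 *s (p \<cdot> A0) + 2 *s (p \<cdot> A1) + 2 *s (p \<cdot> A2))
         - 4 *s (p \<cdot> p) - (4 * \<eta>) *s (p \<cdot> s0 + p \<cdot> s1)"
      unfolding mult_commute[of q p] unfolding q_def bilinear
      by (rule eq_by_functionals) (simp only: functional_simps, algebra)
    have al': "al 0 = A0 + s0" "al 1 = A1 + s1" "al 2 = A2 + s0"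
      by (simp_all add: A0_def A1_def A2_def)
    from cases_\<phi> show "f (4 *s (q \<cdot> q)) = f (4 *s ((\<eta> + 1) *s q))"
    proof
      assume "\<phi> = 0 \<and> \<kappa> = \<eta>"
      then have "\<kappa> = \<eta>" by simp
      show ?thesis unfolding q1 q2 pA pp al al' r p_s functional_simps[OF f] \<open>\<kappa> = \<eta>\<close>
        unfolding q_def functional_simps[OF f] by algebra
    next
      assume "\<phi> = 1 \<and> \<kappa> = 1 - \<eta>"
      then have "\<kappa> = 1 - \<eta>" by simp
      show ?thesis unfolding q1 q2 pA pp al al' r p_s functional_simps[OF f] \<open>\<kappa> = 1 - \<eta>\<close>
        unfolding q_def functional_simps[OF f] by algebra
    qed
  qed
  moreover have "(4::'f) \<noteq> 0" using two_neq_0 by (metis mult_2 mult_eq_0_iff numeral_Bit0)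
  ultimately have qq: "q \<cdot> q = (\<eta> + 1) *s q" using scale_left_imp_eq by blast
  have "hat_3C_relations scale mult \<eta> A0 A1 A2 q s0 s1"
    by (unfold_locales; fact two_neq_0 \<eta>_neq i A01 A02 A12 qA qq s_s sA sq)
  then show ?thesis using that[of A0 s0 A1 s1] by (simp add: A0_def A1_def)
qed

end

section \<open>From axes to sequences of axes\<close>

text \<open>The fusion rule as equations between products. In \<open>fus_\<eta>\<eta>\<close>,
  membership in the sum of the eigenspaces for 0 and 1 is expressed by \<open>a\<close> acting twice
  as it does once.\<close>

locale graded_axis = comm_algebra scale mult
  for scale :: "'f::field \<Rightarrow> 'm::ab_group_add \<Rightarrow> 'm" (infixr \<open>*s\<close> 75)
    and mult :: "'m \<Rightarrow> 'm \<Rightarrow> 'm" (infixl \<open>\<cdot>\<close> 70) +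
  fixes \<phi> \<eta> :: 'f and a :: 'm
  assumes \<phi>: "\<phi> * \<phi> = \<phi>" and \<eta>: "\<eta> \<noteq> 0" "\<eta> \<noteq> 1"
    and axis_idem: "a \<cdot> a = a"
    and decomposition:
      "\<exists>x0 x1 xe. a \<cdot> x0 = 0 \<and> a \<cdot> x1 = x1 \<and> a \<cdot> xe = \<eta> *s xe \<and> x = x0 + x1 + xe"
    and fus_00: "a \<cdot> x = 0 \<Longrightarrow> a \<cdot> y = 0 \<Longrightarrow> a \<cdot> (x \<cdot> y) = 0"
    and fus_11: "a \<cdot> x = x \<Longrightarrow> a \<cdot> y = y \<Longrightarrow> a \<cdot> (x \<cdot> y) = x \<cdot> y"
    and fus_01: "a \<cdot> x = 0 \<Longrightarrow> a \<cdot> y = y \<Longrightarrow> a \<cdot> (x \<cdot> y) = \<phi> *s (x \<cdot> y)"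
    and fus_0\<eta>: "a \<cdot> x = 0 \<Longrightarrow> a \<cdot> y = \<eta> *s y \<Longrightarrow> a \<cdot> (x \<cdot> y) = \<eta> *s (x \<cdot> y)"
    and fus_1\<eta>: "a \<cdot> x = x \<Longrightarrow> a \<cdot> y = \<eta> *s y \<Longrightarrow> a \<cdot> (x \<cdot> y) = \<eta> *s (x \<cdot> y)"
    and fus_\<eta>\<eta>: "a \<cdot> x = \<eta> *s x \<Longrightarrow> a \<cdot> y = \<eta> *s y \<Longrightarrow> a \<cdot> (a \<cdot> (x \<cdot> y)) = a \<cdot> (x \<cdot> y)"

context comm_algebra
begin

text \<open>\<Phi> is empty or a singleton. If it is empty, the products of 0- with 1-eigenvectors
  are zero, so that \<phi> = 0 serves for this case too.\<close>

lemma graded_axis_if_axis: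
  assumes "axis \<Phi> \<eta> a" "\<Phi> \<subseteq> {0, 1}" "\<Phi> \<noteq> {0, 1}" "\<eta> \<noteq> 0" "\<eta> \<noteq> 1"
  shows "graded_axis scale mult (if \<Phi> = {1} then 1 else 0) \<eta> a"
proof -
  have fus: "x \<cdot> y \<in> eigenspace_sum a (fusion \<Phi> \<eta> s t)"
    if "s \<in> {0, 1, \<eta>}" "t \<in> {0, 1, \<eta>}" "a \<cdot> x = s *s x" "a \<cdot> y = t *s y" for s t x y
  proof -
    have "\<forall>s\<in>{0, 1, \<eta>}. \<forall>t\<in>{0, 1, \<eta>}. \<forall>x\<in>eigenspace a s. \<forall>y\<in>eigenspace a t.
        x \<cdot> y \<in> eigenspace_sum a (fusion \<Phi> \<eta> s t)"
      using assms(1) unfolding axis_def by (elim conjE)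
    then show ?thesis using that unfolding eigenspace_def by blast
  qed
  have single: "eigenspace_sum a {u} = eigenspace a u" for u
    unfolding eigenspace_sum_def by auto
  have idem: "a \<cdot> a = a" using assms(1) by (simp add: axis_def)
  have dec: "\<exists>x0 x1 xe. a \<cdot> x0 = 0 \<and> a \<cdot> x1 = x1 \<and> a \<cdot> xe = \<eta> *s xe \<and> x = x0 + x1 + xe" for x
  proof -
    have "\<forall>x. \<exists>!(x0, x1, xe). x0 \<in> eigenspace a 0 \<and> x1 \<in> eigenspace a 1 \<and> xe \<in> eigenspace a \<eta> \<and>
        x = x0 + x1 + xe"
      using assms(1) unfolding axis_def by (elim conjE)
    from ex1_implies_ex[OF this[rule_format, of x]] show ?thesis unfolding eigenspace_def by auto
  qed
  have "\<Phi> = {} \<or> \<Phi> = {0} \<or> \<Phi> = {1}" using assms(2,3) by blast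
  then have \<Phi>: "eigenspace_sum a \<Phi> \<subseteq> eigenspace a (if \<Phi> = {1} then 1 else 0)"
    by (auto simp: single) (auto simp: eigenspace_sum_def eigenspace_def)
  have 00: "a \<cdot> (x \<cdot> y) = 0" if "a \<cdot> x = 0" "a \<cdot> y = 0" for x y
    using fus[of 0 0 x y] that by (simp add: fusion_def single eigenspace_def)
  have 11: "a \<cdot> (x \<cdot> y) = x \<cdot> y" if "a \<cdot> x = x" "a \<cdot> y = y" for x y
    using fus[of 1 1 x y] that by (simp add: fusion_def single eigenspace_def)
  have 01: "a \<cdot> (x \<cdot> y) = (if \<Phi> = {1} then 1 else 0) *s (x \<cdot> y)" if "a \<cdot> x = 0" "a \<cdot> y = y" for x y
  proof -
    have "x \<cdot> y \<in> eigenspace_sum a \<Phi>" using fus[of 0 1 x y] that by (simp add: fusion_def)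
    then have "x \<cdot> y \<in> eigenspace a (if \<Phi> = {1} then 1 else 0)" using \<Phi> by blast
    then show ?thesis by (simp only: eigenspace_def mem_Collect_eq)
  qed
  have e0: "a \<cdot> (x \<cdot> y) = \<eta> *s (x \<cdot> y)" if "a \<cdot> x = 0" "a \<cdot> y = \<eta> *s y" for x y
    using fus[of 0 \<eta> x y] that assms(4,5) by (simp add: fusion_def single eigenspace_def)
  have e1: "a \<cdot> (x \<cdot> y) = \<eta> *s (x \<cdot> y)" if "a \<cdot> x = x" "a \<cdot> y = \<eta> *s y" for x y
    using fus[of 1 \<eta> x y] that assms(4,5) by (simp add: fusion_def single eigenspace_def)
  have ee: "a \<cdot> (a \<cdot> (x \<cdot> y)) = a \<cdot> (x \<cdot> y)" if "a \<cdot> x = \<eta> *s x" "a \<cdot> y = \<eta> *s y" for x y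
  proof -
    have "x \<cdot> y \<in> eigenspace_sum a {0, 1}"
      using fus[of \<eta> \<eta> x y] that assms(4,5) by (simp add: fusion_def)
    then obtain u v where "x \<cdot> y = u + v" "a \<cdot> u = 0" "a \<cdot> v = v"
      by (auto simp: eigenspace_sum_def eigenspace_def)
    then show ?thesis by (simp add: mult_add_right)
  qed
  show ?thesis
    by (unfold_locales; (fact assms(4,5) idem dec 00 11 01 e0 e1 ee | simp))
qed

text \<open>
  The automorphism that negates the \<open>\<eta>\<close>-component \<open>y\<close> of \<open>x\<close>: indeed
  \<open>a \<cdot> x - a \<cdot> (a \<cdot> x) = \<eta>(1 - \<eta>) y\<close>.
\<close>

definition miyamoto :: "'f \<Rightarrow> 'm \<Rightarrow> 'm \<Rightarrow> 'm" where
  "miyamoto \<eta> a x = x - (2 / (\<eta> * (1 - \<eta>))) *s (a \<cdot> x - a \<cdot> (a \<cdot> x))"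

section \<open>Miyamoto involutions as automorphisms\<close>

definition alg_endo :: "('m \<Rightarrow> 'm) \<Rightarrow> bool" where
  "alg_endo g \<longleftrightarrow> (\<forall>x y. g (x + y) = g x + g y) \<and> (\<forall>c x. g (c *s x) = c *s g x) \<and>
    (\<forall>x y. g (x \<cdot> y) = g x \<cdot> g y)"

lemma alg_endo_simps:
  assumes "alg_endo g"
  shows "g (x + y) = g x + g y" "g (c *s x) = c *s g x" "g (x \<cdot> y) = g x \<cdot> g y"
    "g (x - y) = g x - g y" "g 0 = 0"
proof -
  show a: "g (x + y) = g x + g y" and s: "g (c *s x) = c *s g x" and "g (x \<cdot> y) = g x \<cdot> g y" for x y c
    using assms by (auto simp: alg_endo_def)
  show "g 0 = 0" using s[of 0 0] by simp
  show "g (x - y) = g x - g y" using a[of "x - y" y] by (simp add: algebra_simps)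
qed

lemma miyamoto_conj:
  assumes "alg_endo g" shows "g (miyamoto \<eta> a x) = miyamoto \<eta> (g a) (g x)"
  unfolding miyamoto_def by (simp add: alg_endo_simps[OF assms])

end

context graded_axis
begin

lemma miyamoto_even: "a \<cdot> (a \<cdot> x) = a \<cdot> x \<Longrightarrow> miyamoto \<eta> a x = x"
  by (simp add: miyamoto_def)

lemma miyamoto_odd: "a \<cdot> x = \<eta> *s x \<Longrightarrow> miyamoto \<eta> a x = - x"
proof -
  assume "a \<cdot> x = \<eta> *s x"
  then have "a \<cdot> x - a \<cdot> (a \<cdot> x) = (\<eta> * (1 - \<eta>)) *s x"
    by (simp add: mult_scale_right scale_right_diff_distrib algebra_simps)
  then have "miyamoto \<eta> a x = x - 2 *s x"
    unfolding miyamoto_def using \<eta> by simp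
  also have "\<dots> = - x"
    by (rule eq_by_functionals) (simp only: functional_simps, algebra)
  finally show ?thesis .
qed

lemma miyamoto_add: "miyamoto \<eta> a (x + y) = miyamoto \<eta> a x + miyamoto \<eta> a y"
  unfolding miyamoto_def bilinear
  by (rule eq_by_functionals) (simp only: functional_simps, algebra)

lemma miyamoto_scale: "miyamoto \<eta> a (c *s x) = c *s miyamoto \<eta> a x"
  unfolding miyamoto_def bilinear
  by (rule eq_by_functionals) (simp only: functional_simps, algebra)

lemma even_odd:
  obtains u v where "x = u + v" "a \<cdot> (a \<cdot> u) = a \<cdot> u" "a \<cdot> v = \<eta> *s v" "miyamoto \<eta> a x = u - v"
    "\<exists>x0 x1. a \<cdot> x0 = 0 \<and> a \<cdot> x1 = x1 \<and> u = x0 + x1"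
proof -
  obtain x0 x1 xe where x: "a \<cdot> x0 = 0" "a \<cdot> x1 = x1" "a \<cdot> xe = \<eta> *s xe" "x = x0 + x1 + xe"
    using decomposition by blast
  then have "a \<cdot> (a \<cdot> (x0 + x1)) = a \<cdot> (x0 + x1)" by (simp add: bilinear)
  moreover from this have "miyamoto \<eta> a x = (x0 + x1) - xe"
    using x by (simp add: miyamoto_add[of "x0 + x1"] miyamoto_even miyamoto_odd)
  ultimately show ?thesis using x that[of "x0 + x1" xe] by blast
qed

text \<open>The fusion rule is graded modulo 2, with the eigenspaces for 0 and 1 even and that for
  \<eta> odd; \<open>U\<close> and \<open>V\<close> are the even and the odd part of the
  product.\<close>

lemma miyamoto_mult: "miyamoto \<eta> a (x \<cdot> y) = miyamoto \<eta> a x \<cdot> miyamoto \<eta> a y"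
proof -
  obtain x0 x1 xe where x: "a \<cdot> x0 = 0" "a \<cdot> x1 = x1" "a \<cdot> xe = \<eta> *s xe" "x = x0 + x1 + xe"
    using decomposition by blast
  obtain y0 y1 ye where y: "a \<cdot> y0 = 0" "a \<cdot> y1 = y1" "a \<cdot> ye = \<eta> *s ye" "y = y0 + y1 + ye"
    using decomposition by blast
  define U where "U = (x0 + x1) \<cdot> (y0 + y1) + xe \<cdot> ye"
  define V where "V = (x0 + x1) \<cdot> ye + (y0 + y1) \<cdot> xe"
  have f: "a \<cdot> (x0 \<cdot> y0) = 0" "a \<cdot> (x1 \<cdot> y1) = x1 \<cdot> y1"
    "a \<cdot> (x0 \<cdot> y1) = \<phi> *s (x0 \<cdot> y1)" "a \<cdot> (y0 \<cdot> x1) = \<phi> *s (y0 \<cdot> x1)"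
    "a \<cdot> (a \<cdot> (xe \<cdot> ye)) = a \<cdot> (xe \<cdot> ye)"
    "a \<cdot> (x0 \<cdot> ye) = \<eta> *s (x0 \<cdot> ye)" "a \<cdot> (x1 \<cdot> ye) = \<eta> *s (x1 \<cdot> ye)"
     "a \<cdot> (y0 \<cdot> xe) = \<eta> *s (y0 \<cdot> xe)" "a \<cdot> (y1 \<cdot> xe) = \<eta> *s (y1 \<cdot> xe)"
    using x y by (simp_all add: fus_00 fus_11 fus_01 fus_0\<eta> fus_1\<eta> fus_\<eta>\<eta>)
  have "a \<cdot> (a \<cdot> U) = a \<cdot> U"
    unfolding U_def by (simp add: bilinear f \<phi> mult_commute[of x1 y0])
  moreover have "a \<cdot> V = \<eta> *s V"
    unfolding V_def by (simp add: bilinear f scale_right_distrib)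
  moreover have "x \<cdot> y = U + V"
    unfolding x(4) y(4) U_def V_def bilinear mult_commute[of y0 xe] mult_commute[of y1 xe] by simp
  ultimately have "miyamoto \<eta> a (x \<cdot> y) = U - V"
    by (simp add: miyamoto_add miyamoto_even miyamoto_odd)
  moreover have "miyamoto \<eta> a x = x0 + x1 - xe" "miyamoto \<eta> a y = y0 + y1 - ye"
    unfolding x(4) y(4) using x y by (simp_all add: miyamoto_add miyamoto_even miyamoto_odd)
  ultimately show ?thesis
    unfolding U_def V_def by (simp add: bilinear mult_commute[of y0 xe] mult_commute[of y1 xe])
qed

lemma miyamoto_involution: "miyamoto \<eta> a (miyamoto \<eta> a x) = x"
proof -
  obtain u v where uv: "x = u + v" "a \<cdot> (a \<cdot> u) = a \<cdot> u" "a \<cdot> v = \<eta> *s v" "miyamoto \<eta> a x = u - v"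
    by (rule even_odd)
  have "miyamoto \<eta> a (u + - v) = u + v"
    using uv(2,3) by (simp only: miyamoto_add) (simp add: miyamoto_even miyamoto_odd mult_minus_right)
  then show ?thesis using uv by simp
qed

lemma alg_endo_miyamoto: "alg_endo (miyamoto \<eta> a)"
  by (simp add: alg_endo_def miyamoto_add miyamoto_scale miyamoto_mult)

lemma miyamoto_self: "miyamoto \<eta> a a = a"
  by (simp add: miyamoto_even axis_idem)

lemma mult_minus_miyamoto: "a \<cdot> (x - miyamoto \<eta> a x) = \<eta> *s (x - miyamoto \<eta> a x)"
proof -
  obtain u v where uv: "x = u + v" "a \<cdot> v = \<eta> *s v" "miyamoto \<eta> a x = u - v"
    by (rule even_odd)
  then have "x - miyamoto \<eta> a x = v + v" by simp
  then show ?thesis using uv by (simp add: bilinear scale_right_distrib)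
qed

lemma mult_plus_miyamoto: "a \<cdot> (a \<cdot> (x + miyamoto \<eta> a x)) = a \<cdot> (x + miyamoto \<eta> a x)"
proof -
  obtain u v where uv: "x = u + v" "a \<cdot> (a \<cdot> u) = a \<cdot> u" "miyamoto \<eta> a x = u - v"
    by (rule even_odd)
  then have "x + miyamoto \<eta> a x = u + u" by simp
  then show ?thesis using uv by (simp add: bilinear)
qed

end

section \<open>The orbit of two axes under their involutions\<close>

context comm_algebra
begin
text \<open>An involutive endomorphism is an automorphism and carries axes to axes; this makes every
  term of the sequence an axis.\<close>

lemma graded_axis_image:
  assumes g: "alg_endo g" "\<And>x. g (g x) = x" and ax: "graded_axis scale mult \<phi> \<eta> a"
  shows "graded_axis scale mult \<phi> \<eta> (g a)"
proof -
  have iff: "g a \<cdot> x = y \<longleftrightarrow> a \<cdot> g x = g y" for x y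
    using alg_endo_simps(3)[OF g(1)] g(2) by metis
  interpret graded_axis scale mult \<phi> \<eta> a by fact
  have dec: "\<exists>x0 x1 xe. g a \<cdot> x0 = 0 \<and> g a \<cdot> x1 = x1 \<and> g a \<cdot> xe = \<eta> *s xe \<and> x = x0 + x1 + xe" for x
  proof -
    obtain x0 x1 xe where x: "a \<cdot> x0 = 0" "a \<cdot> x1 = x1" "a \<cdot> xe = \<eta> *s xe" "g x = x0 + x1 + xe"
      using decomposition by blast
    then have "x = g x0 + g x1 + g xe" by (metis g alg_endo_simps(1))
    moreover have "g a \<cdot> g x0 = 0" "g a \<cdot> g x1 = g x1" "g a \<cdot> g xe = \<eta> *s g xe"
      unfolding iff g(2) alg_endo_simps[OF g(1)] using x by auto
    ultimately show ?thesis by blast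
  qed
  show ?thesis
    by unfold_locales
      (rule dec | simp only: iff g(2) alg_endo_simps[OF g(1)] \<phi> \<eta> axis_idem fus_00 fus_11 fus_01 fus_0\<eta> fus_1\<eta> fus_\<eta>\<eta> not_False_eq_True)+
qed

text \<open>The pair holds two consecutive terms; each step reflects the older one in the newer one.
  Starting from \<open>b\<close> and \<open>a\<close> instead produces the terms of decreasing
  index.\<close>

primrec axis_pair :: "'f \<Rightarrow> 'm \<Rightarrow> 'm \<Rightarrow> nat \<Rightarrow> 'm \<times> 'm" where
  "axis_pair \<eta> a b 0 = (a, b)"
| "axis_pair \<eta> a b (Suc n) =
    (snd (axis_pair \<eta> a b n), miyamoto \<eta> (snd (axis_pair \<eta> a b n)) (fst (axis_pair \<eta> a b n)))"

definition axis_seq :: "'f \<Rightarrow> 'm \<Rightarrow> 'm \<Rightarrow> int \<Rightarrow> 'm" where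
  "axis_seq \<eta> a b n =
    (if 0 \<le> n then fst (axis_pair \<eta> a b (nat n)) else fst (axis_pair \<eta> b a (nat (1 - n))))"

lemma axis_sequence_axis_seq:
  assumes a: "graded_axis scale mult \<phi> \<eta> a" and b: "graded_axis scale mult \<phi> \<eta> b"
    and \<phi>: "\<phi> = 0 \<and> \<kappa> = \<eta> \<or> \<phi> = 1 \<and> \<kappa> = 1 - \<eta>"
    and \<eta>: "(2::'f) \<noteq> 0" "\<eta> \<noteq> 0" "\<eta> \<noteq> 1" "2 * \<eta> \<noteq> 1"
  shows "axis_sequence scale mult (axis_seq \<eta> a b) \<eta> \<phi> \<kappa>"
proof -
  let ?al = "axis_seq \<eta> a b" and ?t = "miyamoto \<eta>"
  note inv = graded_axis.miyamoto_involution and endo = graded_axis.alg_endo_miyamoto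
  have pair: "graded_axis scale mult \<phi> \<eta> (fst (axis_pair \<eta> a b n)) \<and> graded_axis scale mult \<phi> \<eta> (snd (axis_pair \<eta> a b n))"
    if "graded_axis scale mult \<phi> \<eta> a" "graded_axis scale mult \<phi> \<eta> b" for a b n
    by (induction n) (auto simp: that intro: graded_axis_image endo inv)
  have ax: "graded_axis scale mult \<phi> \<eta> (?al n)" for n
    using pair[OF a b] pair[OF b a] by (simp add: axis_seq_def)
  have pos: "fst (axis_pair \<eta> a b (Suc (Suc n))) = ?t (fst (axis_pair \<eta> a b (Suc n))) (fst (axis_pair \<eta> a b n))"
    for a b n by simp
  have step: "?t (?al n) (?al (n - 1)) = ?al (n + 1)" for n
  proof (cases "n \<ge> 1")
    case True
    then have "n = int (Suc (nat (n - 1)))" by simp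
    then obtain k where k: "n = int (Suc k)" ..
    then show ?thesis using pos[where n=k] by (simp add: axis_seq_def nat_add_distrib)
  next
    case False
    then have "n = - int (nat (- n))" by simp
    then obtain k where k: "n = - int k" ..
    \<comment> \<open>The formula for negative indices also holds at 1 and 0, where it overlaps the
      other branch of \<open>axis_seq\<close>.\<close>
    have al: "?al (1 - int j) = fst (axis_pair \<eta> b a j)" for j
    proof (cases "j \<le> 1")
      case True
      then have "j = 0 \<or> j = 1" by linarith
      then show ?thesis by (auto simp: axis_seq_def)
    next
      case False
      then have "\<not> 0 \<le> 1 - int j" "nat (1 - (1 - int j)) = j" by simp_all
      then show ?thesis unfolding axis_seq_def by (simp only: if_False)
    qed
    have "?al (1 - int (Suc (Suc k))) = ?t (?al (1 - int (Suc k))) (?al (1 - int k))"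
      unfolding al by (rule pos)
    moreover have "1 - int (Suc (Suc k)) = n - 1" "1 - int (Suc k) = n" "1 - int k = n + 1"
      using k by simp_all
    ultimately have "?al (n - 1) = ?t (?al n) (?al (n + 1))" by (simp only:)
    then show ?thesis using inv[OF ax] by simp
  qed
  have rev_step: "?t (?al n) (?al (n + 1)) = ?al (n - 1)" for n
    using inv[OF ax, of n "?al (n - 1)"] by (simp add: step)
  \<comment> \<open>Two consecutive distances are carried along because each term is the reflection
    of its second predecessor in its predecessor; \<open>miyamoto_conj\<close> transports this
    relation to the mirror images.\<close>
  have refl: "?t (?al n) (?al (n + int k)) = ?al (n - int k) \<and> ?t (?al n) (?al (n + int (Suc k))) = ?al (n - int (Suc k))"
    for n k
  proof (induction k)
    case 0
    show ?case using rev_step graded_axis.miyamoto_self[OF ax] by simp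
  next
    case (Suc k)
    have "?al (n + int (Suc (Suc k))) = ?t (?al (n + int (Suc k))) (?al (n + int k))"
      using step[of "n + int (Suc k)"] by (simp add: algebra_simps)
    then have "?t (?al n) (?al (n + int (Suc (Suc k)))) = ?t (?al (n - int (Suc k))) (?al (n - int k))"
      using Suc by (simp only: miyamoto_conj[OF endo[OF ax]])
    also have "\<dots> = ?al (n - int (Suc k) - 1)"
      using rev_step[of "n - int (Suc k)"] by (simp add: algebra_simps)
    finally show ?case using Suc by (simp add: algebra_simps)
  qed
  have t: "?t (?al n) (?al m) = ?al (2 * n - m)" for n m
  proof (cases "m \<ge> n")
    case True
    then obtain k where "m = n + int k" using zle_iff_zadd by blast
    then show ?thesis using refl[of n k] by simp
  next
    case False
    then obtain k where "n = m + int k" by (meson zle_iff_zadd linear)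
    then have "?t (?al n) (?al (2 * n - m)) = ?al m" using refl[of n k] by (simp add: algebra_simps)
    then show ?thesis using inv[OF ax] by metis
  qed
  show ?thesis
  proof
    fix n m x y
    show "?al n \<cdot> ?al n = ?al n" "?al n \<cdot> x = x \<Longrightarrow> ?al n \<cdot> y = y \<Longrightarrow> ?al n \<cdot> (x \<cdot> y) = x \<cdot> y"
      "?al n \<cdot> x = 0 \<Longrightarrow> ?al n \<cdot> y = 0 \<Longrightarrow> ?al n \<cdot> (x \<cdot> y) = 0"
      "?al n \<cdot> x = 0 \<Longrightarrow> ?al n \<cdot> y = y \<Longrightarrow> ?al n \<cdot> (x \<cdot> y) = \<phi> *s (x \<cdot> y)"
      using graded_axis.axis_idem[OF ax] graded_axis.fus_11[OF ax] graded_axis.fus_00[OF ax]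
        graded_axis.fus_01[OF ax] by blast+
    show "?al n \<cdot> (?al m - ?al (2 * n - m)) = \<eta> *s (?al m - ?al (2 * n - m))"
      using graded_axis.mult_minus_miyamoto[OF ax, of n "?al m"] by (simp add: t)
    show "?al n \<cdot> (?al n \<cdot> (?al m + ?al (2 * n - m))) = ?al n \<cdot> (?al m + ?al (2 * n - m))"
      using graded_axis.mult_plus_miyamoto[OF ax, of n "?al m"] by (simp add: t)
  qed (use \<phi> \<eta> in auto)
qed

lemma hat_3C_relations_of_axes:
  assumes "axis \<Phi> \<eta> a" "axis \<Phi> \<eta> b" "\<Phi> \<subseteq> {0, 1}" "\<Phi> \<noteq> {0, 1}"
    and \<eta>: "(2::'f) \<noteq> 0" "\<eta> \<noteq> 0" "\<eta> \<noteq> 1" "2 * \<eta> \<noteq> 1"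
  obtains A0 A1 A2 q s0 s1 where "a = A0 + s0" "b = A1 + s1"
    "hat_3C_relations scale mult \<eta> A0 A1 A2 q s0 s1"
proof -
  define \<phi> \<kappa> :: 'f where "\<phi> = (if \<Phi> = {1} then 1 else 0)" and "\<kappa> = (if \<Phi> = {1} then 1 - \<eta> else \<eta>)"
  have "graded_axis scale mult \<phi> \<eta> a" "graded_axis scale mult \<phi> \<eta> b"
    unfolding \<phi>_def using assms by (simp_all only: graded_axis_if_axis not_False_eq_True)
  then interpret axis_sequence scale mult "axis_seq \<eta> a b" \<eta> \<phi> \<kappa>
    by (rule axis_sequence_axis_seq) (use \<eta> in \<open>auto simp: \<phi>_def \<kappa>_def\<close>)
  have "axis_seq \<eta> a b 0 = a" "axis_seq \<eta> a b 1 = b" by (simp_all add: axis_seq_def)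
  then show ?thesis using relations that by metis
qed

end

section \<open>Homomorphisms from concrete algebras\<close>

lemma UNIV_3: "(UNIV :: 3 set) = {0, 1, -1}"
proof -
  have "card {0, 1, -1 :: 3} = 3" by (simp add: card_insert_if)
  then show ?thesis by (intro card_subset_eq[symmetric]) simp_all
qed

lemma exhaust_3: obtains "k = (0::3)" | "k = 1" | "k = -1"
  using UNIV_3 by blast

lemma sum_3: "(\<Sum>k\<in>UNIV. g k) = g (0::3) + g 1 + (g (-1) :: 'a::comm_monoid_add)"
  unfolding UNIV_3 by (simp add: add.assoc)

lemma sum_option_3:
  "(\<Sum>k\<in>UNIV. g k) = g None + g (Some (0::3)) + g (Some 1) + (g (Some (-1)) :: 'a::comm_monoid_add)"
  unfolding UNIV_option_conv UNIV_3 by (simp add: add.assoc)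

context comm_algebra
begin

definition alg_hom :: "('f, 'a) alg \<Rightarrow> ('a \<Rightarrow> 'm) \<Rightarrow> bool" where
  "alg_hom A g \<longleftrightarrow> carrier A = UNIV \<and> (\<forall>x y. g (add A x y) = g x + g y) \<and>
    (\<forall>c x. g (smult A c x) = c *s g x) \<and> (\<forall>x y. g (alg.mult A x y) = g x \<cdot> g y)"

lemma alg_homD:
  assumes "alg_hom A g"
  shows "carrier A = UNIV" "g (add A x y) = g x + g y" "g (smult A c x) = c *s g x"
    "g (alg.mult A x y) = g x \<cdot> g y"
  using assms by (auto simp: alg_hom_def)

text \<open>The range is a subalgebra that contains the generators.\<close>

lemma surj_alg_hom:
  assumes g: "alg_hom A g" and gen: "subalgebra hull {a, b} = UNIV" and S: "g ` S = {a, b}"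
  shows "surj g"
proof -
  note hom = alg_homD[OF g]
  have "subalgebra (range g)"
    unfolding subalgebra_def subspace_def
  proof (intro conjI ballI allI)
    show "0 \<in> range g" using hom(3)[of 0] by (metis rangeI scale_zero_left)
  qed (use hom in \<open>auto simp: image_iff; metis\<close>)+
  moreover have "{a, b} \<subseteq> range g" using S by auto
  ultimately have "subalgebra hull {a, b} \<subseteq> range g" by (simp add: hull_minimal)
  then show ?thesis using gen by auto
qed

lemma isomorphic_if_inj:
  assumes g: "alg_hom A g" and gen: "subalgebra hull {a, b} = UNIV" and S: "g ` S = {a, b}"
    and inj: "inj g"
  shows "(type_alg scale mult, {a, b}) \<cong> (A, S)"
proof -
  note hom = alg_homD[OF g]
  have surj: "surj g" by (rule surj_alg_hom[OF g gen S])
  then have gi: "g (inv g x) = x" for x by (simp add: surj_f_inv_f)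
  have ig: "inv g (g x) = x" for x using inj by simp
  have "bij (inv g)" using inj surj by (metis bijI bij_imp_bij_inv)
  moreover have "inv g ` {a, b} = S" unfolding S[symmetric] using inj by (simp add: image_inv_f_f)
  moreover have "inv g (x + y) = add A (inv g x) (inv g y)" for x y by (metis hom(2) gi ig)
  moreover have "inv g (c *s x) = smult A c (inv g x)" for c x by (metis hom(3) gi ig)
  moreover have "inv g (x \<cdot> y) = alg.mult A (inv g x) (inv g y)" for x y by (metis hom(4) gi ig)
  ultimately show ?thesis
    unfolding isomorphic_def using hom(1) by (auto simp: type_alg_def intro!: exI[of _ "inv g"])
qed

text \<open>The isomorphism maps \<open>w\<close> to its fibre under \<open>g\<close>; by
  \<open>ker\<close> the fibres are exactly the cosets.\<close>

lemma isomorphic_quotient: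
  assumes g: "alg_hom A g" and gen: "subalgebra hull {a, b} = UNIV" and S: "g ` S = {a, b}"
    and ker: "\<And>x y. g x = g y \<longleftrightarrow> (\<exists>c. y = add A x (smult A c v))"
  shows "(type_alg scale mult, {a, b}) \<cong> axial_quotient (A, S) v"
proof -
  note hom = alg_homD[OF g]
  have surj: "surj g" by (rule surj_alg_hom[OF g gen S])
  define I where "I = range (\<lambda>c. smult A c v)"
  define F where "F w = g -` {w}" for w
  have coset: "coset A I x = F (g x)" for x
  proof (rule set_eqI)
    fix y
    have "y \<in> coset A I x \<longleftrightarrow> (\<exists>c. y = add A x (smult A c v))" by (auto simp: coset_def I_def)
    also have "\<dots> \<longleftrightarrow> g x = g y" by (simp only: ker)
    finally show "y \<in> coset A I x \<longleftrightarrow> y \<in> F (g x)" by (auto simp: F_def)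
  qed
  have inF: "x \<in> F w \<longleftrightarrow> g x = w" for x w by (simp add: F_def)
  have ne: "\<exists>x. g x = w" for w using surj by (metis surjD)
  have "inj F"
  proof (rule injI)
    fix u w assume "F u = F w"
    then show "u = w" using ne[of u] inF by metis
  qed
  moreover have "range F = range (coset A I)"
    unfolding coset using surj by (simp add: image_image[of F g UNIV, symmetric])
  ultimately have bij: "bij_betw F UNIV (range (coset A I))" by (simp add: bij_betw_def)
  have add: "F (u + w) = (\<Union>x\<in>F u. \<Union>y\<in>F w. coset A I (add A x y))" for u w
    unfolding coset hom(2) using ne[of u] ne[of w] by (auto simp: inF)
  have mul: "F (u \<cdot> w) = (\<Union>x\<in>F u. \<Union>y\<in>F w. coset A I (alg.mult A x y))" for u w
    unfolding coset hom(4) using ne[of u] ne[of w] by (auto simp: inF)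
  have sc: "F (c *s u) = (\<Union>x\<in>F u. coset A I (smult A c x))" for u c
    unfolding coset hom(3) using ne[of u] by (auto simp: inF)
  have img: "F ` {a, b} = coset A I ` S"
    unfolding S[symmetric] image_image coset ..
  have ax: "axial_quotient (A, S) v = (quotient_alg A I, coset A I ` S)"
    by (simp add: axial_quotient_def I_def Let_def)
  show ?thesis
    unfolding ax isomorphic_def prod.case type_alg_def quotient_alg_def alg.simps hom(1)
    by (intro exI[of _ F] conjI ballI allI bij add mul sc img)
qed

lemma alg_hom_line: "e \<cdot> e = e \<Longrightarrow> alg_hom line_alg (\<lambda>t. t *s e)"
  by (simp add: alg_hom_def line_alg_def scale_left_distrib bilinear)

lemma alg_hom_direct_sum:
  assumes "alg_hom A g" "alg_hom B h" "\<And>x y. g x \<cdot> h y = 0"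
  shows "alg_hom (A \<oplus> B) (\<lambda>x. g (fst x) + h (snd x))"
  unfolding alg_hom_def direct_sum_def
  by (auto simp: alg_homD[OF assms(1)] alg_homD[OF assms(2)] bilinear assms(3)
      mult_commute[of "h _" "g _"] scale_right_distrib algebra_simps)

lemma mult_sum_left: "(\<Sum>i\<in>I. x i) \<cdot> y = (\<Sum>i\<in>I. x i \<cdot> y)"
  by (induction I rule: infinite_finite_induct) (simp_all add: mult_add_left)

lemma mult_sum_right: "y \<cdot> (\<Sum>i\<in>I. x i) = (\<Sum>i\<in>I. y \<cdot> x i)"
  by (induction I rule: infinite_finite_induct) (simp_all add: mult_add_right)

lemma alg_hom_basis:
  fixes v :: "'i::finite \<Rightarrow> 'm"
  assumes "\<And>i j. v i \<cdot> v j = (\<Sum>k\<in>UNIV. c i j k *s v k)"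
  shows "alg_hom (basis_alg c) (\<lambda>x. \<Sum>i\<in>UNIV. x i *s v i)"
proof -
  have "(\<Sum>i\<in>UNIV. x i *s v i) \<cdot> (\<Sum>j\<in>UNIV. y j *s v j) =
      (\<Sum>k\<in>UNIV. (\<Sum>i\<in>UNIV. \<Sum>j\<in>UNIV. x i * y j * c i j k) *s v k)" for x y
  proof -
    have "(\<Sum>i\<in>UNIV. x i *s v i) \<cdot> (\<Sum>j\<in>UNIV. y j *s v j) =
        (\<Sum>i\<in>UNIV. \<Sum>j\<in>UNIV. \<Sum>k\<in>UNIV. (x i * y j * c i j k) *s v k)"
      by (simp add: mult_sum_left mult_sum_right mult_scale_left mult_scale_right assms scale_sum_right ac_simps)
        (rule sum.swap)
    also have "\<dots> = (\<Sum>i\<in>UNIV. \<Sum>k\<in>UNIV. \<Sum>j\<in>UNIV. (x i * y j * c i j k) *s v k)"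
      by (intro sum.cong refl sum.swap)
    also have "\<dots> = (\<Sum>k\<in>UNIV. \<Sum>i\<in>UNIV. \<Sum>j\<in>UNIV. (x i * y j * c i j k) *s v k)"
      by (rule sum.swap)
    finally show ?thesis by (simp add: scale_sum_left)
  qed
  then show ?thesis
    by (simp add: alg_hom_def basis_alg_def scale_left_distrib sum.distrib scale_sum_right)
qed

end

section \<open>Classification\<close>

context hat_3C_relations
begin

text \<open>\<open>s0\<close> and \<open>s1\<close> are exchanged as well, so that the two
  generators trade places.\<close>

lemma swap_01: "hat_3C_relations scale mult \<eta> A1 A0 A2 q s1 s0"
  by unfold_locales (use two \<eta> A_idem A_mult q_A q_q s_mult s0_A s1_A in \<open>simp_all add: mult_commute add.commute\<close>)

lemma swap_12: "hat_3C_relations scale mult \<eta> A0 A2 A1 q s0 s1"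
  by unfold_locales (use two \<eta> A_idem A_mult q_A q_q s_mult s0_A s1_A in \<open>simp_all add: mult_commute add.commute\<close>)

text \<open>The first two relations of \<open>A_mult\<close> give two expressions for
  \<open>q\<close>, once \<open>A0 \<cdot> A2 = A0\<close> is obtained by multiplying the first one
  by \<open>A0\<close>. They differ by \<open>(2 * \<eta>) *s (A2 - A0)\<close>.\<close>

lemma collapse:
  assumes "A0 = A1" shows "A2 = A0" "q = (\<eta> + 1) *s A0"
proof -
  have q1: "q = (2 * \<eta>) *s A0 + (1 - \<eta>) *s A2"
  proof (rule eq_by_functionals)
    fix f assume f: "functional f"
    show "f q = f ((2 * \<eta>) *s A0 + (1 - \<eta>) *s A2)"
      using arg_cong[OF A_mult(1), of f] unfolding assms[symmetric] A_idem functional_simps[OF f] by algebra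
  qed
  have "(1 - \<eta>) *s (A0 \<cdot> A2) = (1 - \<eta>) *s A0"
  proof (rule eq_by_functionals)
    fix f assume f: "functional f"
    have "A0 \<cdot> q = (\<eta> + 1) *s A0" using q_A(1) by (simp add: mult_commute)
    then have "(2 * \<eta>) *s A0 + (1 - \<eta>) *s (A0 \<cdot> A2) = (\<eta> + 1) *s A0"
      unfolding q1 by (simp add: bilinear A_idem)
    from arg_cong[OF this, of f] show "f ((1 - \<eta>) *s (A0 \<cdot> A2)) = f ((1 - \<eta>) *s A0)"
      unfolding functional_simps[OF f] by algebra
  qed
  then have A02: "A0 \<cdot> A2 = A0" using \<eta> by simp
  have q2: "q = (\<eta> + 1) *s A2"
  proof (rule eq_by_functionals)
    fix f assume f: "functional f"
    show "f q = f ((\<eta> + 1) *s A2)"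
      using arg_cong[OF A_mult(2), of f] unfolding assms[symmetric] A02 functional_simps[OF f] by algebra
  qed
  have "(2 * \<eta>) *s A2 = (2 * \<eta>) *s A0"
  proof (rule eq_by_functionals)
    fix f assume f: "functional f"
    show "f ((2 * \<eta>) *s A2) = f ((2 * \<eta>) *s A0)"
      using arg_cong[OF trans[OF q1[symmetric] q2], of f] unfolding functional_simps[OF f] by algebra
  qed
  then show "A2 = A0" using two \<eta> by simp
  with q2 show "q = (\<eta> + 1) *s A0" by simp
qed

lemma A_distinct:
  assumes "A0 \<noteq> A1" shows "A0 \<noteq> A2" "A1 \<noteq> A2"
proof -
  interpret s12: hat_3C_relations scale mult \<eta> A0 A2 A1 q s0 s1 by (rule swap_12)
  interpret s: hat_3C_relations scale mult \<eta> A1 A0 A2 q s1 s0 by (rule swap_01)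
  interpret ss: hat_3C_relations scale mult \<eta> A1 A2 A0 q s1 s0 by (rule s.swap_12)
  show "A0 \<noteq> A2" "A1 \<noteq> A2" using assms s12.collapse(1) ss.collapse(1) by auto
qed

text \<open>\<open>A1 - A2\<close> is an \<eta>-eigenvector of \<open>A0\<close>, whereas
  \<open>q\<close>, \<open>A0\<close> and \<open>A1 + A2\<close> lie in the sum of the eigenspaces
  for 0 and 1. Multiplying the relation by \<open>A0\<close> twice and once and subtracting isolates
  the \<eta>-part.\<close>

lemma coeff_12_eq:
  assumes "x *s q + y0 *s A0 + y1 *s A1 + y2 *s A2 = 0" "A1 \<noteq> A2"
  shows "y1 = y2"
proof -
  have "(4 * (\<eta> * (\<eta> - 1) * (y1 - y2))) *s (A1 - A2) = 0"
  proof (rule eq_by_functionals)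
    fix f assume f: "functional f"
    have q: "A0 \<cdot> q = (\<eta> + 1) *s A0" using q_A(1) by (simp add: mult_commute)
    have V: "A0 \<cdot> (x *s q + y0 *s A0 + y1 *s A1 + y2 *s A2) = 0"
      "A0 \<cdot> (A0 \<cdot> (x *s q + y0 *s A0 + y1 *s A1 + y2 *s A2)) = 0"
      unfolding assms(1) by simp_all
    note * = V[THEN arg_cong[where f=f], unfolded bilinear A_idem q functional_simps[OF f]]
    note ** = A_mult(1,2)[THEN arg_cong[where f=f], unfolded functional_simps[OF f]]
    have "A0 \<cdot> (2 *s (A0 \<cdot> A1)) = A0 \<cdot> ((\<eta> + 1) *s (A0 + A1) + (1 - \<eta>) *s A2 - q)"
      "A0 \<cdot> (2 *s (A0 \<cdot> A2)) = A0 \<cdot> ((\<eta> + 1) *s (A0 + A2) + (1 - \<eta>) *s A1 - q)"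
      by (simp_all only: A_mult)
    note *** = this[THEN arg_cong[where f=f], unfolded bilinear A_idem q functional_simps[OF f]]
    show "f ((4 * (\<eta> * (\<eta> - 1) * (y1 - y2))) *s (A1 - A2)) = f 0"
      using * ** *** unfolding functional_simps[OF f] by algebra
  qed
  moreover have "(4::'f) \<noteq> 0" using two by (metis mult_2 mult_eq_0_iff numeral_Bit0)
  ultimately show ?thesis using assms(2) \<eta> by simp
qed

text \<open>Vanishes exactly if the relations are those of \<open>3C\<close>, in which \<open>q\<close> is the sum of the axes.\<close>

definition rad where "rad = q - (A0 + A1 + A2)"

text \<open>As \<open>rad\<close> is symmetric in the three axes, the same holds for
  \<open>A1\<close> and \<open>A2\<close>.\<close>

lemma mult_rad: "A0 \<cdot> rad = rad"
proof -
  have "2 *s (A0 \<cdot> rad) = 2 *s rad"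
  proof (rule eq_by_functionals)
    fix f assume f: "functional f"
    have q: "A0 \<cdot> q = (\<eta> + 1) *s A0" using q_A(1) by (simp add: mult_commute)
    note ** = A_mult(1,2)[THEN arg_cong[where f=f], unfolded functional_simps[OF f]]
    show "f (2 *s (A0 \<cdot> rad)) = f (2 *s rad)"
      unfolding rad_def bilinear A_idem q functional_simps[OF f] using ** by algebra
  qed
  then show ?thesis by (rule scale_left_imp_eq[OF two])
qed

text \<open>By symmetry the coefficients of the axes agree, so the relation reads
  \<open>(x + y0) *s q - y0 *s rad = 0\<close>. Multiplying it by \<open>A0\<close> and by
  \<open>A1\<close> gives equal multiples of these distinct elements, which must vanish.\<close>

lemma coeff_kernel:
  assumes ker: "x *s q + y0 *s A0 + y1 *s A1 + y2 *s A2 = 0" and neq: "A0 \<noteq> A1"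
  shows "y0 = y1" "y1 = y2" "(x + y0) * (\<eta> + 1) = 0" "y0 *s rad = 0" "(x + y0) *s q = 0"
proof -
  note d = A_distinct[OF neq]
  show y12: "y1 = y2" by (rule coeff_12_eq[OF ker d(2)])
  interpret s: hat_3C_relations scale mult \<eta> A1 A0 A2 q s1 s0 by (rule swap_01)
  have rad: "s.rad = rad" by (simp add: rad_def s.rad_def add_ac)
  have "x *s q + y1 *s A1 + y0 *s A0 + y2 *s A2 = 0" using ker by (simp add: add_ac)
  then have "y0 = y2" using d(1) by (rule s.coeff_12_eq)
  with y12 show y01: "y0 = y1" by simp
  have V: "(x + y0) *s q - y0 *s rad = 0"
  proof (rule eq_by_functionals)
    fix f assume f: "functional f"
    show "f ((x + y0) *s q - y0 *s rad) = f 0"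
      using arg_cong[OF ker, of f] unfolding y12[symmetric] y01[symmetric] rad_def functional_simps[OF f]
      by algebra
  qed
  have "((x + y0) * (\<eta> + 1)) *s A0 - y0 *s rad = 0" "((x + y0) * (\<eta> + 1)) *s A1 - y0 *s rad = 0"
    using arg_cong[OF V, of "\<lambda>v. A0 \<cdot> v"] arg_cong[OF V, of "\<lambda>v. A1 \<cdot> v"] s.mult_rad
    by (simp_all add: bilinear mult_rad rad mult_commute[of _ q] q_A)
  then have "((x + y0) * (\<eta> + 1)) *s A0 = ((x + y0) * (\<eta> + 1)) *s A1" by simp
  then show c: "(x + y0) * (\<eta> + 1) = 0" using neq by (metis scale_left_imp_eq)
  then show r: "y0 *s rad = 0"
    using \<open>((x + y0) * (\<eta> + 1)) *s A0 - y0 *s rad = 0\<close> by (simp only: scale_zero_left) simp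
  show "(x + y0) *s q = 0" using V r by simp
qed

section \<open>Homomorphisms from \<open>3C\<close> with and without the hat\<close>

definition B :: "3 \<Rightarrow> 'm" where
  "B k = (if k = 0 then A0 else if k = 1 then A1 else A2)"

definition hat_hom :: "(3 option \<Rightarrow> 'f) \<Rightarrow> 'm" where
  "hat_hom x = (\<Sum>i\<in>UNIV. x i *s (case i of None \<Rightarrow> q | Some k \<Rightarrow> B k))"

definition hom_3C :: "(3 \<Rightarrow> 'f) \<Rightarrow> 'm" where
  "hom_3C x = (\<Sum>i\<in>UNIV. x i *s B i)"

lemma halved_products:
  "A0 \<cdot> A1 = (- (1 / 2)) *s q + ((\<eta> + 1) / 2) *s A0 + ((\<eta> + 1) / 2) *s A1 + ((1 - \<eta>) / 2) *s A2"
  "A0 \<cdot> A2 = (- (1 / 2)) *s q + ((\<eta> + 1) / 2) *s A0 + ((1 - \<eta>) / 2) *s A1 + ((\<eta> + 1) / 2) *s A2"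
  "A1 \<cdot> A2 = (- (1 / 2)) *s q + ((1 - \<eta>) / 2) *s A0 + ((\<eta> + 1) / 2) *s A1 + ((\<eta> + 1) / 2) *s A2"
proof -
  have half: "x = (1 / 2) *s y" if "2 *s x = y" for x y
    using two unfolding that[symmetric] by simp
  show "A0 \<cdot> A1 = (- (1 / 2)) *s q + ((\<eta> + 1) / 2) *s A0 + ((\<eta> + 1) / 2) *s A1 + ((1 - \<eta>) / 2) *s A2"
    "A0 \<cdot> A2 = (- (1 / 2)) *s q + ((\<eta> + 1) / 2) *s A0 + ((1 - \<eta>) / 2) *s A1 + ((\<eta> + 1) / 2) *s A2"
    "A1 \<cdot> A2 = (- (1 / 2)) *s q + ((1 - \<eta>) / 2) *s A0 + ((\<eta> + 1) / 2) *s A1 + ((\<eta> + 1) / 2) *s A2"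
    using A_mult[THEN half] by (simp_all add: scale_right_distrib scale_right_diff_distrib add_ac)
qed

lemma alg_hom_hat: "alg_hom (alg_hat_3C \<eta>) hat_hom"
proof -
  have "(case i of None \<Rightarrow> q | Some k \<Rightarrow> B k) \<cdot> (case j of None \<Rightarrow> q | Some k \<Rightarrow> B k)
     = (\<Sum>k\<in>UNIV. hat_3C_coeff \<eta> i j k *s (case k of None \<Rightarrow> q | Some k \<Rightarrow> B k))" for i j
  proof (cases i; cases j)
    fix i' j' assume "i = Some i'" "j = Some j'"
    then show ?thesis
      by (cases i' rule: exhaust_3; cases j' rule: exhaust_3)
        (simp_all add: sum_option_3 basis_vec_def B_def A_idem halved_products mult_commute[of A1 A0]
          mult_commute[of A2 A0] mult_commute[of A2 A1])
  next
    fix j' assume "i = None" "j = Some j'"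
    then show ?thesis
      by (cases j' rule: exhaust_3) (simp_all add: sum_option_3 basis_vec_def B_def q_A)
  next
    fix i' assume "i = Some i'" "j = None"
    then show ?thesis
      by (cases i' rule: exhaust_3) (simp_all add: sum_option_3 basis_vec_def B_def q_A mult_commute[of _ q])
  qed (simp add: sum_option_3 basis_vec_def q_q)
  from alg_hom_basis[OF this] show ?thesis
    unfolding alg_hat_3C_def hat_hom_def .
qed

lemma alg_hom_3C:
  assumes "rad = 0" shows "alg_hom (alg_3C \<eta>) hom_3C"
proof -
  have q: "q = A0 + A1 + A2" using assms by (simp add: rad_def)
  have "\<eta> / 2 = - (1 / 2) + (\<eta> + 1) / 2" "- (\<eta> / 2) = - (1 / 2) + (1 - \<eta>) / 2"
    by (simp_all add: add_divide_distrib diff_divide_distrib)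
  then have e: "(\<eta> / 2) *s x = (- (1 / 2)) *s x + ((\<eta> + 1) / 2) *s x"
    "(- (\<eta> / 2)) *s x = (- (1 / 2)) *s x + ((1 - \<eta>) / 2) *s x" for x
    by (metis scale_left_distrib)+
  have p: "A0 \<cdot> A1 = (\<eta> / 2) *s A0 + (\<eta> / 2) *s A1 + (- (\<eta> / 2)) *s A2"
    "A0 \<cdot> A2 = (\<eta> / 2) *s A0 + (- (\<eta> / 2)) *s A1 + (\<eta> / 2) *s A2"
    "A1 \<cdot> A2 = (- (\<eta> / 2)) *s A0 + (\<eta> / 2) *s A1 + (\<eta> / 2) *s A2"
    unfolding halved_products unfolding q e scale_right_distrib
    by (simp_all only: add_ac)
  have "B i \<cdot> B j = (\<Sum>k\<in>UNIV. (if i = j then basis_vec i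
     else (\<lambda>k. if k \<in> {i, j} then \<eta> / 2 else - (\<eta> / 2))) k *s B k)" for i j
    by (cases i rule: exhaust_3; cases j rule: exhaust_3)
      (simp_all add: sum_3 basis_vec_def B_def A_idem p mult_commute[of A1 A0]
          mult_commute[of A2 A0] mult_commute[of A2 A1])
  from alg_hom_basis[OF this] show ?thesis
    unfolding alg_3C_def hom_3C_def .
qed

lemma hat_hom_vec: "hat_hom (hat_a_vec 0) = A0" "hat_hom (hat_a_vec 1) = A1"
  by (simp_all add: hat_hom_def sum_option_3 basis_vec_def B_def)

lemma hom_3C_vec: "hom_3C (a_vec 0) = A0" "hom_3C (a_vec 1) = A1"
  by (simp_all add: hom_3C_def sum_3 basis_vec_def B_def)

lemma s_hom: "s0 \<cdot> hat_hom x = 0" "s1 \<cdot> hat_hom x = 0" "s0 \<cdot> hom_3C y = 0" "s1 \<cdot> hom_3C y = 0"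
  by (simp_all add: hat_hom_def hom_3C_def sum_option_3 sum_3 B_def bilinear s0_A s1_A)

end

section \<open>Separating orthogonal summands\<close>

context comm_algebra
begin

text \<open>Multiplication by \<open>s\<close> isolates its coefficient.\<close>

lemma line_coeff_eq:
  assumes "s \<cdot> s = s" "s \<noteq> 0" "\<And>x. s \<cdot> g x = 0" "g x + t *s s = g y + u *s s"
  shows "t = u" "g x = g y"
proof -
  have "s \<cdot> (g x + t *s s) = s \<cdot> (g y + u *s s)" using assms(4) by simp
  then have "t *s s = u *s s" by (simp add: bilinear assms(1,3))
  then show "t = u" using assms(2) by simp
  then show "g x = g y" using assms(4) by simp
qed

lemma alg_hom_2A:
  assumes "s0 \<cdot> s0 = s0" "s1 \<cdot> s1 = s1" "s0 \<cdot> s1 = 0"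
  shows "alg_hom alg_2A (\<lambda>u. fst u *s s0 + snd u *s s1)"
  unfolding alg_2A_def
  by (rule alg_hom_direct_sum) (simp_all add: alg_hom_line bilinear assms)

lemma coeff_2A_eq:
  assumes "s0 \<cdot> s0 = s0" "s1 \<cdot> s1 = s1" "s0 \<cdot> s1 = 0" "s0 \<noteq> 0" "s1 \<noteq> 0"
    and "\<And>x. s0 \<cdot> g x = 0" "\<And>x. s1 \<cdot> g x = 0"
    and eq: "g x + (fst u *s s0 + snd u *s s1) = g y + (fst w *s s0 + snd w *s s1)"
  shows "u = w" "g x = g y"
proof -
  have "s1 \<cdot> s0 = 0" using assms(3) by (simp add: mult_commute)
  then have "s1 \<cdot> (g x + fst u *s s0) = 0" for x u by (simp add: bilinear assms)
  \<comment> \<open>First \<open>s1\<close> is split off, with the \<open>s0\<close>-component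
    counted as part of the map, and then \<open>s0\<close>.\<close>
  from line_coeff_eq[of s1 "\<lambda>(x, t). g x + t *s s0" "(x, fst u)" "snd u" "(y, fst w)" "snd w"]
  have 1: "snd u = snd w" "g x + fst u *s s0 = g y + fst w *s s0"
    using eq assms \<open>s1 \<cdot> s0 = 0\<close> by (auto simp: add.assoc bilinear)
  from line_coeff_eq[OF assms(1,4,6) 1(2)] have 2: "fst u = fst w" "g x = g y" .
  show "u = w" using 1 2 by (simp add: prod_eq_iff)
  show "g x = g y" by (rule 2)
qed

lemma isomorphic_direct_sum:
  assumes g: "alg_hom K g" and h: "alg_hom L h" "\<And>x y. g x \<cdot> h y = 0"
    and sep: "\<And>x y u w. g x + h u = g y + h w \<Longrightarrow> u = w \<and> g x = g y"
    and gen: "subalgebra hull {g k0 + h l0, g k1 + h l1} = UNIV"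
    and inj: "inj g"
  shows "(type_alg scale mult, {g k0 + h l0, g k1 + h l1}) \<cong> (K \<oplus> L, {(k0, l0), (k1, l1)})"
proof (rule isomorphic_if_inj[OF alg_hom_direct_sum[OF g h] gen])
  show "inj (\<lambda>x. g (fst x) + h (snd x))"
    using sep inj by (auto intro!: injI simp: prod_eq_iff inj_eq)
qed simp

lemma isomorphic_direct_sum_quotient:
  assumes g: "alg_hom K g" and h: "alg_hom L h" "\<And>x y. g x \<cdot> h y = 0"
    and sep: "\<And>x y u w. g x + h u = g y + h w \<Longrightarrow> u = w \<and> g x = g y"
    and gen: "subalgebra hull {g k0 + h l0, g k1 + h l1} = UNIV"
    and ker: "\<And>x y. g x = g y \<longleftrightarrow> (\<exists>c. y = add K x (smult K c v))"
    and zero: "\<And>c u. add L u (smult L c z) = u"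
  shows "(type_alg scale mult, {g k0 + h l0, g k1 + h l1}) \<cong>
    axial_quotient (K \<oplus> L, {(k0, l0), (k1, l1)}) (v, z)"
proof (rule isomorphic_quotient[OF alg_hom_direct_sum[OF g h] gen])
  fix x y
  have "g (fst x) + h (snd x) = g (fst y) + h (snd y) \<longleftrightarrow> snd x = snd y \<and> g (fst x) = g (fst y)"
    using sep by auto
  also have "\<dots> \<longleftrightarrow> (\<exists>c. y = add (K \<oplus> L) x (smult (K \<oplus> L) c (v, z)))"
    by (auto simp: ker direct_sum_def zero prod_eq_iff)
  finally show "g (fst x) + h (snd x) = g (fst y) + h (snd y) \<longleftrightarrow>
    (\<exists>c. y = add (K \<oplus> L) x (smult (K \<oplus> L) c (v, z)))" .
qed simp

end

section \<open>Identification of the generated algebra\<close>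

locale hat_3C_generated = hat_3C_relations +
  assumes gen: "subalgebra hull {A0 + s0, A1 + s1} = UNIV"
begin

abbreviation "X \<equiv> (type_alg scale mult, {A0 + s0, A1 + s1})"

context
  fixes K :: "('a, 'c) alg" and g :: "'c \<Rightarrow> 'b" and k0 k1 :: 'c
  assumes g: "alg_hom K g" "g k0 = A0" "g k1 = A1" "\<And>x. s0 \<cdot> g x = 0" "\<And>x. s1 \<cdot> g x = 0"
    and s: "s0 \<noteq> 0 \<Longrightarrow> s1 \<noteq> 0"
begin

text \<open>\<open>K\<close> stands for the part orthogonal to \<open>s0\<close> and
  \<open>s1\<close>; none, one or both of these are nonzero. Assumption \<open>s\<close> makes
  \<open>s1\<close> the nonzero one if there is just one, which amounts to a choice of order of the
  generators.\<close>

lemma extensions_inj: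
  assumes "inj g"
  shows "X \<cong> (K, {k0, k1}) \<or> X \<cong> (K \<oplus> line_alg, {(k0, 0), (k1, 1)}) \<or>
    X \<cong> (K \<oplus> alg_2A, {(k0, 1, 0), (k1, 0, 1)})"
proof -
  consider "s0 = 0" "s1 = 0" | "s0 = 0" "s1 \<noteq> 0" | "s0 \<noteq> 0" "s1 \<noteq> 0" using s by blast
  then show ?thesis
  proof cases
    case 1
    then show ?thesis using isomorphic_if_inj[OF g(1) gen, of "{k0, k1}"] g assms by simp
  next
    case 2
    have "(type_alg scale mult, {g k0 + 0 *s s1, g k1 + 1 *s s1}) \<cong> (K \<oplus> line_alg, {(k0, 0), (k1, 1)})"
      by (rule isomorphic_direct_sum[OF g(1) alg_hom_line[OF s_mult(2)]])
        (use gen g 2 assms s_mult line_coeff_eq[OF s_mult(2) 2(2) g(5)] in \<open>auto simp: bilinear mult_commute[of "g _"]\<close>)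
    then show ?thesis using 2 g by simp
  next
    case 3
    let ?h = "\<lambda>u. fst u *s s0 + snd u *s s1"
    have orth: "g x \<cdot> ?h u = 0" for x u by (simp add: bilinear mult_commute[of "g _"] g(4,5))
    have sep: "u = w \<and> g x = g y" if "g x + ?h u = g y + ?h w" for x y u w
      using coeff_2A_eq[OF s_mult 3 g(4,5) that] by blast
    have "(type_alg scale mult, {g k0 + ?h (1, 0), g k1 + ?h (0, 1)}) \<cong> (K \<oplus> alg_2A, {(k0, 1, 0), (k1, 0, 1)})"
      by (rule isomorphic_direct_sum[OF g(1) alg_hom_2A[OF s_mult] orth sep _ assms]) (use gen g in simp_all)
    then show ?thesis using g by simp
  qed
qed

text \<open>The vector \<open>v\<close> spans the kernel of \<open>g\<close>; since
  \<open>s0\<close> and \<open>s1\<close> split off, the kernel of the map on the direct sum has no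
  component in the second summand.\<close>

lemma extensions_quotient:
  assumes ker: "\<And>x y. g x = g y \<longleftrightarrow> (\<exists>c. y = add K x (smult K c v))"
  shows "X \<cong> axial_quotient (K, {k0, k1}) v \<or>
    X \<cong> axial_quotient (K \<oplus> line_alg, {(k0, 0), (k1, 1)}) (v, 0) \<or>
    X \<cong> axial_quotient (K \<oplus> alg_2A, {(k0, 1, 0), (k1, 0, 1)}) (v, 0, 0)"
proof -
  consider "s0 = 0" "s1 = 0" | "s0 = 0" "s1 \<noteq> 0" | "s0 \<noteq> 0" "s1 \<noteq> 0" using s by blast
  then show ?thesis
  proof cases
    case 1
    then show ?thesis using isomorphic_quotient[OF g(1) gen _ ker, of "{k0, k1}"] g by simp
  next
    case 2
    have "(type_alg scale mult, {g k0 + 0 *s s1, g k1 + 1 *s s1}) \<cong>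
        axial_quotient (K \<oplus> line_alg, {(k0, 0), (k1, 1)}) (v, 0)"
      by (rule isomorphic_direct_sum_quotient[OF g(1) alg_hom_line[OF s_mult(2)] _ _ _ ker])
        (use gen g 2 s_mult line_coeff_eq[OF s_mult(2) 2(2) g(5)] in
          \<open>auto simp: bilinear mult_commute[of "g _"] line_alg_def\<close>)
    then show ?thesis using 2 g by simp
  next
    case 3
    let ?h = "\<lambda>u. fst u *s s0 + snd u *s s1"
    have orth: "g x \<cdot> ?h u = 0" for x u by (simp add: bilinear mult_commute[of "g _"] g(4,5))
    have sep: "u = w \<and> g x = g y" if "g x + ?h u = g y + ?h w" for x y u w
      using coeff_2A_eq[OF s_mult 3 g(4,5) that] by blast
    have "(type_alg scale mult, {g k0 + ?h (1, 0), g k1 + ?h (0, 1)}) \<cong>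
        axial_quotient (K \<oplus> alg_2A, {(k0, 1, 0), (k1, 0, 1)}) (v, 0, 0)"
      by (rule isomorphic_direct_sum_quotient[OF g(1) alg_hom_2A[OF s_mult] orth sep _ ker])
        (use gen g in \<open>simp_all add: line_alg_def alg_2A_def direct_sum_def\<close>)
    then show ?thesis using g by simp
  qed
qed

end

lemma hat_hom_eq:
  "hat_hom x = x None *s q + x (Some 0) *s A0 + x (Some 1) *s A1 + x (Some (-1)) *s A2"
  by (simp add: hat_hom_def sum_option_3 B_def)

lemma hom_3C_eq: "hom_3C x = x 0 *s A0 + x 1 *s A1 + x (-1) *s A2"
  by (simp add: hom_3C_def sum_3 B_def)

text \<open>The difference of the two coordinate vectors represents
  \<open>u *s q - t *s rad\<close>, where \<open>u = y None - x None + t\<close>.\<close>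

lemma hat_hom_kernel:
  assumes "hat_hom x = hat_hom y" "A0 \<noteq> A1"
  shows "\<exists>t. (\<forall>k. y (Some k) - x (Some k) = t) \<and> (y None - x None + t) * (\<eta> + 1) = 0 \<and> t *s rad = 0 \<and>
    (y None - x None + t) *s q = 0"
proof -
  have "(y None - x None) *s q + (y (Some 0) - x (Some 0)) *s A0 + (y (Some 1) - x (Some 1)) *s A1
      + (y (Some (-1)) - x (Some (-1))) *s A2 = 0"
    using assms(1) by (simp add: hat_hom_eq scale_left_diff_distrib algebra_simps)
  note k = coeff_kernel[OF this assms(2)]
  have "y (Some k) - x (Some k) = y (Some 0) - x (Some 0)" for k
    using k(1,2) by (cases k rule: exhaust_3) simp_all
  then show ?thesis using k(3-5) by blast
qed

lemma hom_3C_kernel: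
  assumes "hom_3C x = hom_3C y" "A0 \<noteq> A1"
  shows "\<exists>t. (\<forall>k. y k - x k = t) \<and> t * (\<eta> + 1) = 0 \<and> t *s q = 0"
proof -
  have "0 *s q + (y 0 - x 0) *s A0 + (y 1 - x 1) *s A1 + (y (-1) - x (-1)) *s A2 = 0"
    using assms(1) by (simp add: hom_3C_eq scale_left_diff_distrib algebra_simps)
  note k = coeff_kernel[OF this assms(2)]
  have "y k - x k = y 0 - x 0" for k
    using k(1,2) by (cases k rule: exhaust_3) simp_all
  moreover have "(y 0 - x 0) * (\<eta> + 1) = 0" "(y 0 - x 0) *s q = 0"
    using k(3,5) by (simp_all only: add_0)
  ultimately show ?thesis by blast
qed

text \<open>If \<open>A0 = A1\<close>, the part generated by the axes collapses to a line or to
  zero. Otherwise \<open>rad\<close> decides between \<open>3C\<close> and its hat version, and a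
  further kernel occurs only if \<eta> = -1 and \<open>q = 0\<close>.\<close>

lemma classification:
  assumes s: "s0 \<noteq> 0 \<Longrightarrow> s1 \<noteq> 0" and ne: "A0 + s0 \<noteq> 0" "A1 + s1 \<noteq> 0"
  shows "isomorphic_to_one_of_ten X \<eta> \<or> \<eta> = -1 \<and> (
       X \<cong> ax_3C_cross \<or> X \<cong> ax_hat_3C_cross \<or>
       X \<cong> ax_3C0_cross \<or> X \<cong> ax_3C00_cross \<or>
       X \<cong> ax_hat_3C0_cross \<or> X \<cong> ax_hat_3C00_cross)"
proof (cases "A0 = A1")
  case True
  show ?thesis
  proof (cases "A0 = 0")
    case True
    then have ne: "s0 \<noteq> 0" "s1 \<noteq> 0" using ne \<open>A0 = A1\<close> by auto
    let ?h = "\<lambda>u. fst u *s s0 + snd u *s s1"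
    have "u = w" if "?h u = ?h w" for u w
      using coeff_2A_eq[OF s_mult ne, of "\<lambda>_. 0" undefined u undefined w] that by simp
    then have "inj ?h" by (rule injI)
    from isomorphic_if_inj[OF alg_hom_2A[OF s_mult] gen _ this, of "{(1, 0), (0, 1)}"]
    have "X \<cong> ax_2A" using True \<open>A0 = A1\<close> by (simp add: ax_2A_def)
    then show ?thesis by (simp add: isomorphic_to_one_of_ten_def)
  next
    case False
    have "inj (\<lambda>t. t *s A0)" using False by (auto intro: injI)
    from extensions_inj[OF alg_hom_line[OF A_idem(1)] _ _ _ _ s this, of 1 1]
    have "X \<cong> ax_1A \<or> X \<cong> ax_hat_1A \<or> X \<cong> ax_hat_2A"
      using \<open>A0 = A1\<close> s0_A s1_A by (simp add: ax_1A_def ax_hat_1A_def ax_hat_2A_def mult_scale_right)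
    then show ?thesis by (auto simp: isomorphic_to_one_of_ten_def)
  qed
next
  case neq: False
  note hat = alg_hom_hat hat_hom_vec s_hom(1,2) s
  have \<eta>1: "\<eta> + 1 = 0 \<longleftrightarrow> \<eta> = -1" by (simp add: eq_neg_iff_add_eq_0)
  show ?thesis
  proof (cases "rad = 0")
    case rad: True
    note c = alg_hom_3C[OF rad] hom_3C_vec s_hom(3,4) s
    show ?thesis
    proof (cases "\<eta> = -1 \<and> q = 0")
      case False
      have "inj hom_3C"
      proof (rule injI)
        fix x y assume "hom_3C x = hom_3C y"
        then obtain t where t: "\<And>k. y k - x k = t" "t * (\<eta> + 1) = 0" "t *s q = 0"
          using hom_3C_kernel[OF _ neq] by blast
        then have "t = 0" using False \<eta>1 by auto
        then show "x = y" using t(1) by (auto simp: fun_eq_iff)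
      qed
      from extensions_inj[OF c this] show ?thesis
        by (auto simp: isomorphic_to_one_of_ten_def ax_3C_def ax_3C0_def ax_3C00_def)
    next
      case True
      \<comment> \<open>The sum of the axes equals \<open>q\<close>, which is zero here, and spans
        the kernel.\<close>
      have "hom_3C x = hom_3C y \<longleftrightarrow> (\<exists>t. y = add (alg_3C \<eta>) x (smult (alg_3C \<eta>) t a_sum))" for x y
      proof
        assume "hom_3C x = hom_3C y"
        then obtain t where t: "\<And>k. y k - x k = t"
          using hom_3C_kernel[OF _ neq] by blast
        have "y k = x k + t * a_sum k" for k
          using t[of k] by (cases k rule: exhaust_3) (auto simp: a_sum_def basis_vec_def algebra_simps)
        then show "\<exists>t. y = add (alg_3C \<eta>) x (smult (alg_3C \<eta>) t a_sum)"
          by (auto simp: alg_3C_def basis_alg_def)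
      next
        assume "\<exists>t. y = add (alg_3C \<eta>) x (smult (alg_3C \<eta>) t a_sum)"
        moreover have "hom_3C a_sum = q"
          using rad unfolding rad_def eq_iff_diff_eq_0[symmetric]
          by (simp add: hom_3C_eq a_sum_def basis_vec_def)
        ultimately show "hom_3C x = hom_3C y" using alg_homD[OF c(1)] True by auto
      qed
      from extensions_quotient[OF c this] show ?thesis
        using True by (auto simp: ax_3C_cross_def ax_3C0_cross_def ax_3C00_cross_def ax_3C_def ax_3C0_def ax_3C00_def)
    qed
  next
    case rad: False
    show ?thesis
    proof (cases "\<eta> = -1 \<and> q = 0")
      case False
      have "inj hat_hom"
      proof (rule injI)
        fix x y assume "hat_hom x = hat_hom y"
        then obtain t where t: "\<And>k. y (Some k) - x (Some k) = t" "(y None - x None + t) * (\<eta> + 1) = 0" "t *s rad = 0"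
            "(y None - x None + t) *s q = 0"
          using hat_hom_kernel[OF _ neq] by blast
        \<comment> \<open>The axis coordinates agree as \<open>rad\<close> is nonzero; the
          \<open>q\<close>-coordinates then agree because \<eta> + 1 or \<open>q\<close> is
          nonzero.\<close>
        then have "t = 0" using rad by simp
        then have "y None = x None" using t(2,4) False \<eta>1 by auto
        then show "x = y" using t(1) \<open>t = 0\<close> by (metis (no_types) ext eq_iff_diff_eq_0 option.exhaust)
      qed
      from extensions_inj[OF hat this] show ?thesis
        by (auto simp: isomorphic_to_one_of_ten_def ax_hat_3C_def ax_hat_3C0_def ax_hat_3C00_def)
    next
      case True
      have "hat_hom x = hat_hom y \<longleftrightarrow> (\<exists>t. y = add (alg_hat_3C \<eta>) x (smult (alg_hat_3C \<eta>) t hat_q_vec))" for x y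
      proof
        assume "hat_hom x = hat_hom y"
        then obtain t where t: "\<And>k. y (Some k) - x (Some k) = t" "t *s rad = 0"
          using hat_hom_kernel[OF _ neq] by blast
        then have "y (Some k) = x (Some k)" for k using rad by simp
        then have "y k = x k + (y None - x None) * hat_q_vec k" for k
          by (cases k) (auto simp: basis_vec_def)
        then show "\<exists>t. y = add (alg_hat_3C \<eta>) x (smult (alg_hat_3C \<eta>) t hat_q_vec)"
          by (auto simp: alg_hat_3C_def basis_alg_def)
      next
        assume "\<exists>t. y = add (alg_hat_3C \<eta>) x (smult (alg_hat_3C \<eta>) t hat_q_vec)"
        moreover have "hat_hom hat_q_vec = q" by (simp add: hat_hom_eq basis_vec_def)
        ultimately show "hat_hom x = hat_hom y" using alg_homD[OF hat(1)] True by auto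
      qed
      from extensions_quotient[OF hat this] show ?thesis
        using True by (auto simp: ax_hat_3C_cross_def ax_hat_3C0_cross_def ax_hat_3C00_cross_def
          ax_hat_3C_def ax_hat_3C0_def ax_hat_3C00_def)
    qed
  qed
qed

end

text \<open>In the second part, \<eta> \<noteq> 1/2 says that the characteristic is not 3, where -1
  and 1/2 coincide.\<close>

theorem theorem3:
  fixes scale :: "'f::field \<Rightarrow> 'm::ab_group_add \<Rightarrow> 'm"
    and m :: "'m \<Rightarrow> 'm \<Rightarrow> 'm"
    and \<Phi> :: "'f set" and \<eta> :: 'f and a b :: 'm
    and X :: "('f, 'm) axial"
  assumes char: "CHAR('f) \<noteq> 2"
    and Phi: "\<Phi> \<subseteq> {0, 1}"
    and eta: "\<eta> \<notin> {0, 1}"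
    and alg: "comm_algebra scale m"
    and gen: "comm_algebra.two_generated scale m \<Phi> \<eta> a b"
    and X: "X = (type_alg scale m, {a, b})"
  shows "(\<Phi> \<noteq> {0, 1} \<and> \<eta> \<noteq> 1 / 2 \<and> \<eta> \<noteq> -1 \<longrightarrow> isomorphic_to_one_of_ten X \<eta>) \<and>
    (\<Phi> \<noteq> {0, 1} \<and> \<eta> \<noteq> 1 / 2 \<and> \<eta> = -1 \<longrightarrow>
       isomorphic_to_one_of_ten X (-1) \<or>
       X \<cong> ax_3C_cross \<or> X \<cong> ax_hat_3C_cross \<or>
       X \<cong> ax_3C0_cross \<or> X \<cong> ax_3C00_cross \<or>
       X \<cong> ax_hat_3C0_cross \<or> X \<cong> ax_hat_3C00_cross)"
proof -
  interpret comm_algebra scale m by (rule alg)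
  have two: "(2::'f) \<noteq> 0"
  proof
    assume "(2::'f) = 0"
    then have "CHAR('f) dvd 2" using of_nat_eq_0_iff_char_dvd[of 2, where 'a='f] by simp
    then have "CHAR('f) \<le> 2" "CHAR('f) \<noteq> 0" by (auto dest: dvd_imp_le intro: ccontr)
    then show False using char CHAR_not_1[where 'a='f] by auto
  qed
  have ax: "axis \<Phi> \<eta> a" "axis \<Phi> \<eta> b" and hull: "subalgebra hull {a, b} = UNIV"
    using gen unfolding two_generated_def by auto
  have ne: "a \<noteq> 0" "b \<noteq> 0" using ax unfolding axis_def by auto
  have *: "isomorphic_to_one_of_ten X \<eta> \<or> \<eta> = -1 \<and> (
       X \<cong> ax_3C_cross \<or> X \<cong> ax_hat_3C_cross \<or>
       X \<cong> ax_3C0_cross \<or> X \<cong> ax_3C00_cross \<or>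
       X \<cong> ax_hat_3C0_cross \<or> X \<cong> ax_hat_3C00_cross)"
    if \<Phi>: "\<Phi> \<noteq> {0, 1}" and half: "\<eta> \<noteq> 1 / 2"
  proof -
    have \<eta>: "\<eta> \<noteq> 0" "\<eta> \<noteq> 1" "2 * \<eta> \<noteq> 1" using eta half two by (auto simp: field_simps)
    obtain A0 A1 A2 q s0 s1 where ab: "a = A0 + s0" "b = A1 + s1"
      and rel: "hat_3C_relations scale m \<eta> A0 A1 A2 q s0 s1"
      using hat_3C_relations_of_axes[OF ax Phi \<Phi> two \<eta>] by metis
    show ?thesis
    proof (cases "s0 \<noteq> 0 \<longrightarrow> s1 \<noteq> 0")
      case True
      have "hat_3C_generated scale m \<eta> A0 A1 A2 q s0 s1"
        using rel hull ab by (simp add: hat_3C_generated_def hat_3C_generated_axioms_def)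
      from hat_3C_generated.classification[OF this] show ?thesis
        using True ne ab X by simp
    next
      case False
      \<comment> \<open>Only \<open>s0\<close> is nonzero, so the two axes are exchanged.\<close>
      have "hat_3C_generated scale m \<eta> A1 A0 A2 q s1 s0"
        using hat_3C_relations.swap_01[OF rel] hull ab
        by (simp add: hat_3C_generated_def hat_3C_generated_axioms_def insert_commute)
      from hat_3C_generated.classification[OF this] show ?thesis
        using False ne ab X by (simp add: insert_commute)
    qed
  qed
  show ?thesis
  proof (cases "\<eta> = -1")
    case True
    from *[unfolded this] show ?thesis unfolding True by blast
  next
    case False
    with * show ?thesis by blast
  qed
qed

end
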